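(* For $i=1,2$, the space $(X_i,\|\cdot\|_{X_i})$ is a reflexive Banach space.
   Context: Setting. $N\ge1$, $\Omega\subset\mathbb{R}^N$ is open and bounded with Lipschitz boundary, $C\Omega:=\mathbb{R}^N\setminus\Omega$, $\beta\in L^\infty(C\Omega)$ with $\beta\ge0$. For $i=1,2$: - $s_i:\mathbb{R}^N\times\mathbb{R}^N\to(0,1)$ is continuous, symmetric, with $0<s_i^-:=\inf s_i\le s_i^+:=\sup s_i<1$. - $a^i:\mathbb{R}^N\times\mathbb{R}^N\times\mathbb{R}\to\mathbb{R}$ satisfies $a^i(x,y,t)=a^i(y,x,t)$, and $\varphi^i_{x,y}(t):=a^i(x,y,|t|)t$ for $t\ne0$, $\varphi^i_{x,y}(0):=0$, is an increasing homeomorphism of $\mathbb{R}$ onto itself. Put $\Phi^i_{x,y}(t):=\int_0^t\varphi^i_{x,y}(\tau)\,d\tau$ for $t\ge0$ and $\widehat\Phi^i_x:=\Phi^i_{x,x}$. These are Musielak functions (in particular measurable in the space variables). - There are constants $\varphi_i^\pm$ with $1<\varphi_i^-\le \dfrac{t\varphi^i_{x,y}(t)}{\Phi^i_{x,y}(t)}\le\varphi_i^+<\infty$ for all $(x,y)$ and all $t>0$; and $t\mapsto\Phi^i_{x,y}(\sqrt t)$ is convex on $[0,\infty)$. Function space. For measurable $u:\mathbb{R}^N\to\mathbb{R}$ let $\|u\|_{X_i}:=[u]_{s_i(x,y),\Phi^i_{x,y}}+\|u\|_{\widehat\Phi^i_x}+\|u\|_{\widehat\Phi^i_x,\beta,C\Omega}$,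 where $[u]_{s_i(x,y),\Phi^i_{x,y}}=\inf\{\lambda>0:\int_{\mathbb{R}^{2N}\setminus(C\Omega)^2}\Phi^i_{x,y}\big(\tfrac{|u(x)-u(y)|}{\lambda|x-y|^{s_i(x,y)}}\big)\tfrac{dx\,dy}{|x-y|^N}\le1\}$, $\|u\|_{\widehat\Phi^i_x}=\inf\{\lambda>0:\int_\Omega\widehat\Phi^i_x(|u(x)|/\lambda)\,dx\le1\}$, $\|u\|_{\widehat\Phi^i_x,\beta,C\Omega}=\inf\{\lambda>0:\int_{C\Omega}\beta(x)\widehat\Phi^i_x(|u(x)|/\lambda)\,dx\le1\}$. $X_i$ is the space of measurable $u:\mathbb{R}^N\to\mathbb{R}$ with $\|u\|_{X_i}<\infty$, functions equal a.e. in $\mathbb{R}^N$ being identified. *)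

theory Defs
  imports "HOL-Analysis.Analysis"
begin

section \<open>Normed spaces on a carrier, completeness, reflexivity\<close>

text \<open>
  The space of the main statement is a set of equivalence classes that depends on term
  parameters, so it cannot be an instance of the type class \<open>banach\<close>. The structure is therefore
  carried by a record, which also makes it possible to form the dual and the bidual.
\<close>

record 'v nspace =
  vecs :: "'v set"
  vzero :: 'v
  vadd :: "'v \<Rightarrow> 'v \<Rightarrow> 'v"
  vscale :: "real \<Rightarrow> 'v \<Rightarrow> 'v"
  vnorm :: "'v \<Rightarrow> real"

locale real_normed_space =
  fixes E :: "'v nspace"
  assumes zero_closed: "vzero E \<in> vecs E"
    and add_closed: "\<lbrakk>x \<in> vecs E; y \<in> vecs E\<rbrakk> \<Longrightarrow> vadd E x y \<in> vecs E"
    and scale_closed: "x \<in> vecs E \<Longrightarrow> vscale E c x \<in> vecs E"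
    and add_assoc: "\<lbrakk>x \<in> vecs E; y \<in> vecs E; z \<in> vecs E\<rbrakk>
          \<Longrightarrow> vadd E (vadd E x y) z = vadd E x (vadd E y z)"
    and add_commute: "\<lbrakk>x \<in> vecs E; y \<in> vecs E\<rbrakk> \<Longrightarrow> vadd E x y = vadd E y x"
    and add_zero: "x \<in> vecs E \<Longrightarrow> vadd E x (vzero E) = x"
    and add_minus: "x \<in> vecs E \<Longrightarrow> vadd E x (vscale E (- 1) x) = vzero E"
    and scale_add_right: "\<lbrakk>x \<in> vecs E; y \<in> vecs E\<rbrakk>
          \<Longrightarrow> vscale E c (vadd E x y) = vadd E (vscale E c x) (vscale E c y)"
    and scale_add_left: "x \<in> vecs E
          \<Longrightarrow> vscale E (c + d) x = vadd E (vscale E c x) (vscale E d x)"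
    and scale_scale: "x \<in> vecs E \<Longrightarrow> vscale E c (vscale E d x) = vscale E (c * d) x"
    and scale_one: "x \<in> vecs E \<Longrightarrow> vscale E 1 x = x"
    and norm_nonneg: "x \<in> vecs E \<Longrightarrow> 0 \<le> vnorm E x"
    and norm_eq_zero: "x \<in> vecs E \<Longrightarrow> vnorm E x = 0 \<longleftrightarrow> x = vzero E"
    and norm_scale: "x \<in> vecs E \<Longrightarrow> vnorm E (vscale E c x) = \<bar>c\<bar> * vnorm E x"
    and norm_triangle: "\<lbrakk>x \<in> vecs E; y \<in> vecs E\<rbrakk>
          \<Longrightarrow> vnorm E (vadd E x y) \<le> vnorm E x + vnorm E y"

text \<open>
  The locale \<open>Metric_space\<close> requires symmetry and nonnegativity also off the carrier, hence the
  default value 0 there.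
\<close>

definition vdist :: "'v nspace \<Rightarrow> 'v \<Rightarrow> 'v \<Rightarrow> real" where
  "vdist E x y =
     (if x \<in> vecs E \<and> y \<in> vecs E then vnorm E (vadd E x (vscale E (- 1) y)) else 0)"

definition banach_space :: "'v nspace \<Rightarrow> bool" where
  "banach_space E \<longleftrightarrow> real_normed_space E \<and> Metric_space.mcomplete (vecs E) (vdist E)"

text \<open>
  Functionals are taken extensional (equal to \<open>undefined\<close> off the carrier), so that functionals
  agreeing on the carrier are equal.
\<close>

definition dual_space :: "'v nspace \<Rightarrow> ('v \<Rightarrow> real) nspace" where
  "dual_space E =
    \<lparr> vecs = {f \<in> extensional (vecs E).
        (\<forall>x\<in>vecs E. \<forall>y\<in>vecs E. f (vadd E x y) = f x + f y) \<and>
        (\<forall>c. \<forall>x\<in>vecs E. f (vscale E c x) = c * f x) \<and>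
        (\<exists>C. \<forall>x\<in>vecs E. \<bar>f x\<bar> \<le> C * vnorm E x)},
      vzero = (\<lambda>x\<in>vecs E. 0),
      vadd = (\<lambda>f g. \<lambda>x\<in>vecs E. f x + g x),
      vscale = (\<lambda>c f. \<lambda>x\<in>vecs E. c * f x),
      vnorm = (\<lambda>f. SUP x\<in>{x \<in> vecs E. vnorm E x \<le> 1}. \<bar>f x\<bar>) \<rparr>"

definition bidual_embedding :: "'v nspace \<Rightarrow> 'v \<Rightarrow> (('v \<Rightarrow> real) \<Rightarrow> real)" where
  "bidual_embedding E x = (\<lambda>f\<in>vecs (dual_space E). f x)"

definition reflexive_space :: "'v nspace \<Rightarrow> bool" where
  "reflexive_space E \<longleftrightarrow>
     bidual_embedding E ` vecs E = vecs (dual_space (dual_space E))"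

section \<open>Domains with Lipschitz boundary\<close>

text \<open>
  Near each boundary point, and in the orthogonal coordinates given by a unit vector \<open>e\<close> and
  its orthogonal complement, \<open>\<Omega>\<close> is the region strictly above the graph of a Lipschitz function
  on that complement; \<open>x - (x \<bullet> e) *\<^sub>R e\<close> is the orthogonal projection of \<open>x\<close>.
\<close>

definition lipschitz_boundary :: "'a::euclidean_space set \<Rightarrow> bool" where
  "lipschitz_boundary \<Omega> \<longleftrightarrow>
    (\<forall>z\<in>frontier \<Omega>. \<exists>r>0. \<exists>e. norm e = 1 \<and>
      (\<exists>L \<gamma>. lipschitz_on L {y. y \<bullet> e = 0} (\<gamma> :: 'a \<Rightarrow> real) \<and>
        \<Omega> \<inter> ball z r = {x \<in> ball z r. \<gamma> (x - (x \<bullet> e) *\<^sub>R e) < x \<bullet> e}))"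

section \<open>Musielak functions\<close>

definition N_function :: "(real \<Rightarrow> real) \<Rightarrow> bool" where
  "N_function A \<longleftrightarrow>
     continuous_on {0..} A \<and> convex_on {0..} A \<and> strict_mono_on {0..} A \<and>
     A 0 = 0 \<and> (\<forall>t>0. 0 < A t) \<and>
     ((\<lambda>t. A t / t) \<longlongrightarrow> 0) (at_right 0) \<and> filterlim (\<lambda>t. A t / t) at_top at_top"

definition musielak_function :: "('x::euclidean_space \<Rightarrow> real \<Rightarrow> real) \<Rightarrow> bool" where
  "musielak_function \<Psi> \<longleftrightarrow>
     (\<forall>x. N_function (\<Psi> x)) \<and> (\<forall>t\<ge>0. (\<lambda>x. \<Psi> x t) \<in> borel_measurable lebesgue)"

definition phi_of :: "('a \<Rightarrow> 'a \<Rightarrow> real \<Rightarrow> real) \<Rightarrow> 'a \<Rightarrow> 'a \<Rightarrow> real \<Rightarrow> real" where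
  "phi_of a x y t = (if t = 0 then 0 else a x y \<bar>t\<bar> * t)"

definition Phi_of :: "('a \<Rightarrow> 'a \<Rightarrow> real \<Rightarrow> real) \<Rightarrow> 'a \<Rightarrow> 'a \<Rightarrow> real \<Rightarrow> real" where
  "Phi_of a x y t = integral {0..t} (phi_of a x y)"

definition Phi_hat :: "('a \<Rightarrow> 'a \<Rightarrow> real \<Rightarrow> real) \<Rightarrow> 'a \<Rightarrow> real \<Rightarrow> real" where
  "Phi_hat a x = Phi_of a x x"

section \<open>The function space\<close>

text \<open>
  \<open>\<rho> l\<close> stands for the modular of \<open>u / l\<close>; the infimum is taken in \<open>[0, \<infinity>]\<close>, so it is
  \<open>\<infinity>\<close> when no \<open>l\<close> is admissible.
\<close>

definition luxemburg :: "(real \<Rightarrow> ennreal) \<Rightarrow> ennreal" where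
  "luxemburg \<rho> = Inf {ennreal l | l. 0 < l \<and> \<rho> l \<le> 1}"

definition frac_seminorm ::
  "(real^'n) set \<Rightarrow> (real^'n \<Rightarrow> real^'n \<Rightarrow> real) \<Rightarrow> (real^'n \<Rightarrow> real^'n \<Rightarrow> real \<Rightarrow> real)
    \<Rightarrow> (real^'n \<Rightarrow> real) \<Rightarrow> ennreal" where
  "frac_seminorm \<Omega> s \<Phi> u = luxemburg (\<lambda>l.
     \<integral>\<^sup>+ (x, y) \<in> - ((- \<Omega>) \<times> (- \<Omega>)).
        ennreal (\<Phi> x y (\<bar>u x - u y\<bar> / (l * norm (x - y) powr s x y)) / norm (x - y) ^ CARD('n))
      \<partial>lebesgue)"

definition domain_norm ::
  "(real^'n) set \<Rightarrow> (real^'n \<Rightarrow> real \<Rightarrow> real) \<Rightarrow> (real^'n \<Rightarrow> real) \<Rightarrow> ennreal" where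
  "domain_norm \<Omega> \<Psi> u = luxemburg (\<lambda>l.
     \<integral>\<^sup>+ x \<in> \<Omega>. ennreal (\<Psi> x (\<bar>u x\<bar> / l)) \<partial>lebesgue)"

definition exterior_norm ::
  "(real^'n) set \<Rightarrow> (real^'n \<Rightarrow> real) \<Rightarrow> (real^'n \<Rightarrow> real \<Rightarrow> real) \<Rightarrow> (real^'n \<Rightarrow> real)
    \<Rightarrow> ennreal" where
  "exterior_norm \<Omega> \<beta> \<Psi> u = luxemburg (\<lambda>l.
     \<integral>\<^sup>+ x \<in> - \<Omega>. ennreal (\<beta> x * \<Psi> x (\<bar>u x\<bar> / l)) \<partial>lebesgue)"

definition X_norm ::
  "(real^'n) set \<Rightarrow> (real^'n \<Rightarrow> real) \<Rightarrow> (real^'n \<Rightarrow> real^'n \<Rightarrow> real)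
    \<Rightarrow> (real^'n \<Rightarrow> real^'n \<Rightarrow> real \<Rightarrow> real) \<Rightarrow> (real^'n \<Rightarrow> real) \<Rightarrow> ennreal" where
  "X_norm \<Omega> \<beta> s a u =
     frac_seminorm \<Omega> s (Phi_of a) u + domain_norm \<Omega> (Phi_hat a) u
       + exterior_norm \<Omega> \<beta> (Phi_hat a) u"

definition X_fun ::
  "(real^'n) set \<Rightarrow> (real^'n \<Rightarrow> real) \<Rightarrow> (real^'n \<Rightarrow> real^'n \<Rightarrow> real)
    \<Rightarrow> (real^'n \<Rightarrow> real^'n \<Rightarrow> real \<Rightarrow> real) \<Rightarrow> (real^'n \<Rightarrow> real) set" where
  "X_fun \<Omega> \<beta> s a = {u \<in> borel_measurable lebesgue. X_norm \<Omega> \<beta> s a u < \<infinity>}"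

definition ae_rel :: "((real^'n \<Rightarrow> real) \<times> (real^'n \<Rightarrow> real)) set" where
  "ae_rel = {(u, v). u \<in> borel_measurable lebesgue \<and> v \<in> borel_measurable lebesgue \<and>
                     (AE x in lebesgue. u x = v x)}"

text \<open>
  Operations on classes are induced by those on representatives, in the style of
  \<open>Equiv_Relations\<close>: for congruent operations the unions range over a single class and the image
  under the norm is a singleton.
\<close>

definition X_space ::
  "(real^'n) set \<Rightarrow> (real^'n \<Rightarrow> real) \<Rightarrow> (real^'n \<Rightarrow> real^'n \<Rightarrow> real)
    \<Rightarrow> (real^'n \<Rightarrow> real^'n \<Rightarrow> real \<Rightarrow> real) \<Rightarrow> (real^'n \<Rightarrow> real) set nspace" where
  "X_space \<Omega> \<beta> s a =
    \<lparr> vecs = X_fun \<Omega> \<beta> s a // ae_rel,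
      vzero = ae_rel `` {\<lambda>x. 0},
      vadd = (\<lambda>U V. \<Union>u\<in>U. \<Union>v\<in>V. ae_rel `` {\<lambda>x. u x + v x}),
      vscale = (\<lambda>c U. \<Union>u\<in>U. ae_rel `` {\<lambda>x. c * u x}),
      vnorm = (\<lambda>U. the_elem ((\<lambda>u. enn2real (X_norm \<Omega> \<beta> s a u)) ` U)) \<rparr>"

end

theory Submission
  imports Defs
begin

text \<open>
  Convexity of \<open>t \<mapsto> \<Phi>(sqrt t)\<close> gives Lamperti's inequality
  \<open>\<Phi>(\<bar>a + b\<bar>/2) + \<Phi>(\<bar>a - b\<bar>/2) \<le> (\<Phi>\<bar>a\<bar> + \<Phi>\<bar>b\<bar>)/2\<close>, which integrates to the same inequality for the
  sum \<open>\<rho>\<close> of the three modulars. Together with the growth bound \<open>\<Phi>(rt) \<le> r\<^sup>p \<Phi>(t)\<close> for \<open>r \<ge> 1\<close>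
  it makes the modular unit ball \<open>{\<rho> \<le> 1}\<close> uniformly convex. This ball is equivalent to the unit
  ball of the norm, and the Milman--Pettis argument applies to it directly, without passing to an
  equivalent norm. Completeness follows from almost everywhere convergence of rapidly
  Cauchy sequences and Fatou's lemma for the modular.
\<close>

section \<open>Reflexivity of uniformly convex spaces\<close>

text \<open>The norm is a sum of three Luxemburg norms, and uniform convexity of the summands would
  not carry over to such a sum; modulars, in contrast, add without loss. Lamperti's inequality
  leaves the midpoint of two distant points with modular at most 1 - \<eta>, and the growth bound,
  whose exponent p is the upper exponent \<phi>^+, turns this deficit into a factor q < 1 with q^p =
  1 - \<eta>. Such a factor is all that the Milman--Pettis argument consumes. The factors 3 in the
  norm comparisons come from setting the sum of three gauges against the gauge of the sum.

  The second obstacle is the exterior: \<beta> may vanish there, so the weighted term need not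
  separate functions. Both definiteness of the norm and the almost everywhere limit outside \<Omega>
  come from the pairs with one point in \<Omega> and the other outside it. Weights are absorbed into
  measures and the difference quotient is a linear map, so that all three modulars are instances of
  one integral modular.\<close>

context real_normed_space
begin

definition vdiff where "vdiff x y = vadd E x (vscale E (- 1) y)"

lemma vdiff_closed: "\<lbrakk>x \<in> vecs E; y \<in> vecs E\<rbrakk> \<Longrightarrow> vdiff x y \<in> vecs E"
  by (simp add: vdiff_def add_closed scale_closed)

lemma zero_add: "x \<in> vecs E \<Longrightarrow> vadd E (vzero E) x = x"
  by (metis add_commute add_zero zero_closed)

lemma vdiff_add_vdiff:
  assumes "x \<in> vecs E" "y \<in> vecs E" "z \<in> vecs E"
  shows "vadd E (vdiff x y) (vdiff y z) = vdiff x z"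
proof -
  have c: "vscale E (- 1) y \<in> vecs E" "vscale E (- 1) z \<in> vecs E"
    using assms scale_closed by auto
  have "vadd E (vdiff x y) (vdiff y z) = vadd E x (vadd E (vscale E (- 1) y) (vadd E y (vscale E (- 1) z)))"
    unfolding vdiff_def using assms c by (simp add: add_assoc add_closed)
  also have "vadd E (vscale E (- 1) y) (vadd E y (vscale E (- 1) z))
      = vadd E (vadd E y (vscale E (- 1) y)) (vscale E (- 1) z)"
    using assms c by (metis add_assoc add_commute)
  also have "\<dots> = vscale E (- 1) z"
    using assms c by (simp add: add_minus zero_add)
  finally show ?thesis by (simp add: vdiff_def)
qed

lemma vdiff_swap:
  assumes "x \<in> vecs E" "y \<in> vecs E"
  shows "vdiff y x = vscale E (- 1) (vdiff x y)"
  using assms by (simp add: vdiff_def scale_add_right scale_closed scale_scale scale_one add_commute)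

lemma vnorm_vdiff_commute:
  assumes "x \<in> vecs E" "y \<in> vecs E"
  shows "vnorm E (vdiff x y) = vnorm E (vdiff y x)"
  using assms by (simp add: vdiff_swap[OF assms] norm_scale vdiff_closed)

lemma vnorm_vdiff_triangle:
  assumes "x \<in> vecs E" "y \<in> vecs E" "z \<in> vecs E"
  shows "vnorm E (vdiff x z) \<le> vnorm E (vdiff x y) + vnorm E (vdiff y z)"
  using norm_triangle[OF vdiff_closed vdiff_closed, of x y y z] vdiff_add_vdiff[OF assms] assms by simp

lemma vdist_eq: "\<lbrakk>x \<in> vecs E; y \<in> vecs E\<rbrakk> \<Longrightarrow> vdist E x y = vnorm E (vdiff x y)"
  by (simp add: vdist_def vdiff_def)

lemma vdiff_eq_zero:
  assumes "x \<in> vecs E" "y \<in> vecs E" "vdiff x y = vzero E"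
  shows "x = y"
proof -
  have "vadd E (vdiff x y) y = x"
    using assms(1,2) unfolding vdiff_def
    by (metis add_assoc add_commute add_minus add_zero scale_closed)
  then show ?thesis using assms by (simp add: zero_add)
qed

lemma Metric_space_vdist: "Metric_space (vecs E) (vdist E)"
proof
  show "0 \<le> vdist E x y" for x y
    by (simp add: vdist_def norm_nonneg add_closed scale_closed)
  show "vdist E x y = vdist E y x" for x y
    by (cases "x \<in> vecs E \<and> y \<in> vecs E") (auto simp: vdist_eq vnorm_vdiff_commute, auto simp: vdist_def)
  show "vdist E x y = 0 \<longleftrightarrow> x = y" if "x \<in> vecs E" "y \<in> vecs E" for x y
    using that vdiff_eq_zero[OF that] add_minus[of x]
    by (auto simp: vdist_eq norm_eq_zero vdiff_closed) (simp add: vdiff_def)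
  show "vdist E x z \<le> vdist E x y + vdist E y z"
    if "x \<in> vecs E" "y \<in> vecs E" "z \<in> vecs E" for x y z
    using that by (simp add: vdist_eq vnorm_vdiff_triangle)
qed

sublocale metric: Metric_space "vecs E" "vdist E"
  by (rule Metric_space_vdist)

section \<open>Bounded functionals and the dual norm\<close>

lemma dual_spaceD:
  assumes "f \<in> vecs (dual_space E)"
  shows dual_extensional: "f \<in> extensional (vecs E)"
    and dual_add: "\<lbrakk>x \<in> vecs E; y \<in> vecs E\<rbrakk> \<Longrightarrow> f (vadd E x y) = f x + f y"
    and dual_scale: "x \<in> vecs E \<Longrightarrow> f (vscale E c x) = c * f x"
  using assms by (simp_all add: dual_space_def)

lemma dual_vdiff:
  "\<lbrakk>f \<in> vecs (dual_space E); x \<in> vecs E; y \<in> vecs E\<rbrakk> \<Longrightarrow> f (vdiff x y) = f x - f y"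
  by (simp add: vdiff_def dual_add dual_scale scale_closed)

lemma dual_bounded:
  assumes "f \<in> vecs (dual_space E)"
  obtains C where "0 \<le> C" "\<And>x. x \<in> vecs E \<Longrightarrow> \<bar>f x\<bar> \<le> C * vnorm E x"
proof -
  obtain C where C: "\<forall>x\<in>vecs E. \<bar>f x\<bar> \<le> C * vnorm E x"
    using assms by (auto simp: dual_space_def)
  have "\<bar>f x\<bar> \<le> \<bar>C\<bar> * vnorm E x" if "x \<in> vecs E" for x
    using C that mult_right_mono[OF abs_ge_self[of C] norm_nonneg[OF that]] by fastforce
  then show thesis using that[of "\<bar>C\<bar>"] by simp
qed

lemma dual_scale_closed:
  assumes "f \<in> vecs (dual_space E)"
  shows "vscale (dual_space E) c f \<in> vecs (dual_space E)"
    and "x \<in> vecs E \<Longrightarrow> vscale (dual_space E) c f x = c * f x"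
proof -
  obtain C where C: "0 \<le> C" "\<And>x. x \<in> vecs E \<Longrightarrow> \<bar>f x\<bar> \<le> C * vnorm E x"
    using dual_bounded[OF assms] by blast
  have "\<bar>c * f x\<bar> \<le> (\<bar>c\<bar> * C) * vnorm E x" if "x \<in> vecs E" for x
    using mult_left_mono[OF C(2)[OF that], of "\<bar>c\<bar>"] by (simp add: abs_mult mult.assoc)
  then show "vscale (dual_space E) c f \<in> vecs (dual_space E)"
    using dual_spaceD[OF assms]
    by (auto simp: dual_space_def add_closed scale_closed algebra_simps intro!: exI[of _ "\<bar>c\<bar> * C"])
  show "x \<in> vecs E \<Longrightarrow> vscale (dual_space E) c f x = c * f x"
    by (simp add: dual_space_def)
qed

lemma dual_add_closed:
  assumes "f \<in> vecs (dual_space E)" "g \<in> vecs (dual_space E)"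
  shows "vadd (dual_space E) f g \<in> vecs (dual_space E)"
    and "x \<in> vecs E \<Longrightarrow> vadd (dual_space E) f g x = f x + g x"
proof -
  obtain C where C: "0 \<le> C" "\<And>x. x \<in> vecs E \<Longrightarrow> \<bar>f x\<bar> \<le> C * vnorm E x"
    using dual_bounded[OF assms(1)] by blast
  obtain D where D: "0 \<le> D" "\<And>x. x \<in> vecs E \<Longrightarrow> \<bar>g x\<bar> \<le> D * vnorm E x"
    using dual_bounded[OF assms(2)] by blast
  have "\<bar>f x + g x\<bar> \<le> (C + D) * vnorm E x" if "x \<in> vecs E" for x
    using C(2)[OF that] D(2)[OF that] by (simp add: algebra_simps)
  then show "vadd (dual_space E) f g \<in> vecs (dual_space E)"
    using dual_spaceD[OF assms(1)] dual_spaceD[OF assms(2)]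
    by (auto simp: dual_space_def add_closed scale_closed algebra_simps intro!: exI[of _ "C + D"])
  show "x \<in> vecs E \<Longrightarrow> vadd (dual_space E) f g x = f x + g x"
    by (simp add: dual_space_def)
qed

lemma dual_norm_le:
  assumes "\<And>x. \<lbrakk>x \<in> vecs E; vnorm E x \<le> 1\<rbrakk> \<Longrightarrow> \<bar>f x\<bar> \<le> b"
  shows "vnorm (dual_space E) f \<le> b"
proof -
  have "vzero E \<in> {x \<in> vecs E. vnorm E x \<le> 1}"
    using zero_closed norm_eq_zero[OF zero_closed] by simp
  then show ?thesis
    unfolding dual_space_def using assms by (auto intro!: cSUP_least)
qed

lemma dual_bdd_above:
  assumes f: "f \<in> vecs (dual_space E)"
  shows "bdd_above ((\<lambda>x. \<bar>f x\<bar>) ` {x \<in> vecs E. vnorm E x \<le> 1})"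
proof -
  obtain C where C: "0 \<le> C" "\<And>x. x \<in> vecs E \<Longrightarrow> \<bar>f x\<bar> \<le> C * vnorm E x"
    using dual_bounded[OF f] by blast
  show ?thesis
  proof (intro bdd_aboveI2)
    fix y assume "y \<in> {x \<in> vecs E. vnorm E x \<le> 1}"
    then show "\<bar>f y\<bar> \<le> C" using C(2)[of y] mult_left_mono[of "vnorm E y" 1 C] C(1) by auto
  qed
qed

lemma abs_le_dual_norm:
  assumes f: "f \<in> vecs (dual_space E)" and x: "x \<in> vecs E"
  shows "\<bar>f x\<bar> \<le> vnorm (dual_space E) f * vnorm E x"
proof (cases "vnorm E x = 0")
  case True
  obtain C where "\<And>x. x \<in> vecs E \<Longrightarrow> \<bar>f x\<bar> \<le> C * vnorm E x"
    using dual_bounded[OF f] by blast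
  from this[OF x] True show ?thesis by simp
next
  case False
  define r where "r = vnorm E x"
  have r: "0 < r" using False norm_nonneg[OF x] by (simp add: r_def)
  have y: "vscale E (1 / r) x \<in> {x \<in> vecs E. vnorm E x \<le> 1}"
    using x r by (simp add: scale_closed norm_scale r_def)
  have "\<bar>f (vscale E (1 / r) x)\<bar> \<le> (SUP x\<in>{x \<in> vecs E. vnorm E x \<le> 1}. \<bar>f x\<bar>)"
    by (rule cSUP_upper[OF y dual_bdd_above[OF f]])
  then have "\<bar>f x\<bar> / r \<le> vnorm (dual_space E) f"
    using x r by (simp add: dual_scale[OF f] abs_mult) (simp add: dual_space_def)
  then show ?thesis using r by (simp add: r_def[symmetric] field_simps)
qed

lemma dual_norm_nonneg:
  assumes f: "f \<in> vecs (dual_space E)"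
  shows "0 \<le> vnorm (dual_space E) f"
proof -
  have z: "vzero E \<in> {x \<in> vecs E. vnorm E x \<le> 1}"
    using zero_closed norm_eq_zero[OF zero_closed] by simp
  show ?thesis
    using cSUP_upper[OF z dual_bdd_above[OF f]] by (simp add: dual_space_def order_trans[OF abs_ge_zero])
qed

lemma bidual_embedding_closed:
  assumes x: "x \<in> vecs E"
  shows "bidual_embedding E x \<in> vecs (dual_space (dual_space E))"
  unfolding dual_space_def[of "dual_space E"] bidual_embedding_def
  using x abs_le_dual_norm[OF _ x]
  by (auto simp: dual_add_closed dual_scale_closed mult.commute intro!: exI[of _ "vnorm E x"])

end

text \<open>\<open>B\<close> takes the role of the unit ball: it contains the ball of radius
  \<open>c\<close>, lies in the ball of radius \<open>R\<close>, and the midpoint of two of its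
  points at distance at least \<epsilon> lies in (1 - \<delta>) \<open>B\<close>. The witness
  \<open>z\<close> expresses this without a gauge of \<open>B\<close>, and distances stay those of
  the original norm.\<close>

locale uniformly_convex_body = real_normed_space E for E :: "'v nspace" +
  fixes B :: "'v set" and c R :: real
  assumes body_subset: "B \<subseteq> vecs E"
    and c_pos: "0 < c"
    and ball_subset: "\<lbrakk>x \<in> vecs E; vnorm E x \<le> c\<rbrakk> \<Longrightarrow> x \<in> B"
    and body_bounded: "x \<in> B \<Longrightarrow> vnorm E x \<le> R"
    and body_convex: "0 < \<epsilon> \<Longrightarrow> \<exists>\<delta>>0. \<delta> < 1 \<and> (\<forall>x\<in>B. \<forall>y\<in>B. \<epsilon> \<le> vnorm E (vdiff x y) \<longrightarrow>
          (\<exists>z\<in>B. vadd E x y = vscale E (2 * (1 - \<delta>)) z))"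
    and complete: "metric.mcomplete"
begin

definition polar where
  "polar = {f \<in> vecs (dual_space E). \<forall>x\<in>B. f x \<le> 1}"

lemma polarD:
  assumes "f \<in> polar"
  shows "f \<in> vecs (dual_space E)" "x \<in> B \<Longrightarrow> f x \<le> 1"
  using assms by (auto simp: polar_def)

lemma bodyD: "x \<in> B \<Longrightarrow> x \<in> vecs E"
  using body_subset by blast

text \<open>If x and y were \<epsilon> apart, x + y would be 2 (1 - \<delta>) times a point of
  \<open>B\<close>, where \<open>f\<close> is at most 1, so \<open>f x\<close> and
  \<open>f y\<close> could not both exceed 1 - \<delta>. The \<delta> does not depend on
  \<open>f\<close>, which makes slices of different functionals comparable.\<close>

lemma slice_diameter:
  assumes "0 < \<epsilon>"
  obtains \<delta> where "0 < \<delta>"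
    "\<And>f x y. \<lbrakk>f \<in> polar; x \<in> B; y \<in> B; 1 - \<delta> < f x; 1 - \<delta> < f y\<rbrakk> \<Longrightarrow> vnorm E (vdiff x y) < \<epsilon>"
proof -
  obtain d where d: "0 < d" "d < 1" "\<forall>x\<in>B. \<forall>y\<in>B. \<epsilon> \<le> vnorm E (vdiff x y) \<longrightarrow>
          (\<exists>z\<in>B. vadd E x y = vscale E (2 * (1 - d)) z)"
    using body_convex[OF assms] by auto
  show thesis
  proof (rule that[of d])
    fix f x y
    assume f: "f \<in> polar" and xy: "x \<in> B" "y \<in> B" and fx: "1 - d < f x" and fy: "1 - d < f y"
    show "vnorm E (vdiff x y) < \<epsilon>"
    proof (rule ccontr)
      assume "\<not> ?thesis"
      then obtain z where z: "z \<in> B" "vadd E x y = vscale E (2 * (1 - d)) z"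
        using d xy by fastforce
      have "f x + f y = (2 * (1 - d)) * f z"
        using arg_cong[OF z(2), of f] xy z(1)
        by (simp add: dual_add[OF polarD(1)[OF f]] dual_scale[OF polarD(1)[OF f]] bodyD)
      also have "\<dots> \<le> 2 * (1 - d)"
        using mult_left_mono[OF polarD(2)[OF f z(1)], of "2 * (1 - d)"] d by simp
      finally show False using fx fy by simp
    qed
  qed (use d in auto)
qed

text \<open>Both c x and - c x lie in \<open>B\<close> when x has norm at most 1. The bound makes
  the supremum of a bidual functional over the polar finite.\<close>

lemma polar_dual_norm_le:
  assumes "f \<in> polar"
  shows "vnorm (dual_space E) f \<le> 1 / c"
proof (rule dual_norm_le)
  fix x assume x: "x \<in> vecs E" "vnorm E x \<le> 1"
  have *: "r * f x \<le> 1" if "\<bar>r\<bar> = c" for r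
  proof -
    have "vscale E r x \<in> B"
      using x that mult_left_mono[OF x(2), of c] c_pos
      by (intro ball_subset) (simp_all add: scale_closed norm_scale)
    from polarD(2)[OF assms this] show ?thesis
      by (simp add: dual_scale[OF polarD(1)[OF assms] x(1)])
  qed
  from *[of c] *[of "- c"] c_pos show "\<bar>f x\<bar> \<le> 1 / c"
    by (simp add: field_simps abs_le_iff)
qed

text \<open>
  A norming sequence of functionals in the polar of the body cuts out slices whose diameters
  shrink to 0; their common limit represents the bidual functional. Perturbing the norming
  sequence by a multiple of \<open>g\<close> identifies the value at \<open>g\<close>, so neither Hahn--Banach nor
  Goldstine's theorem is needed.
\<close>

lemma normalized_bidual_represented:
  assumes F: "F \<in> vecs (dual_space (dual_space E))"
    and norming: "\<And>f r. \<lbrakk>f \<in> vecs (dual_space E); 0 < r; r < F f\<rbrakk> \<Longrightarrow> \<exists>x\<in>B. r < f x"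
    and approx: "\<And>r. r < 1 \<Longrightarrow> \<exists>f\<in>polar. r < F f"
  obtains x where "x \<in> vecs E" "\<And>g. g \<in> vecs (dual_space E) \<Longrightarrow> F g = g x"
proof -
  let ?D = "dual_space E"
  have Fadd: "F (vadd ?D f g) = F f + F g" if "f \<in> vecs ?D" "g \<in> vecs ?D" for f g
    using F that by (simp add: dual_space_def[of ?D])
  have Fscale: "F (vscale ?D t f) = t * F f" if "f \<in> vecs ?D" for f t
    using F that by (simp add: dual_space_def[of ?D])
  \<comment> \<open>Starting at 1/2 keeps \<open>1 - e n\<close> strictly positive, as
    \<open>norming\<close> requires of its threshold.\<close>
  define e where "e n = inverse (real (Suc (Suc n)))" for n
  have e: "0 < e n" "e n < 1" for n by (simp_all add: e_def divide_simps)
  have e_mono: "e n \<le> e m" if "m \<le> n" for m n using that by (simp add: e_def)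
  have e_lim: "e \<longlonglongrightarrow> 0"
    unfolding e_def using LIMSEQ_inverse_real_of_nat by (rule LIMSEQ_Suc)
  have "\<forall>n. \<exists>f. f \<in> polar \<and> 1 - e n < F f"
    using approx e by (metis diff_gt_0_iff_gt diff_less_eq less_add_same_cancel1 add.commute)
  then obtain f where f: "\<And>n. f n \<in> polar" "\<And>n. 1 - e n < F (f n)" by metis
  note fD = polarD(1)[OF f(1)]
  have "\<forall>n. \<exists>x. x \<in> B \<and> 1 - e n < f n x"
    using norming[OF fD _ f(2)] e by fastforce
  then obtain x where x: "\<And>n. x n \<in> B" "\<And>n. 1 - e n < f n (x n)" by metis
  note xE = bodyD[OF x(1)]
  have "metric.MCauchy x"
    unfolding metric.MCauchy_def
  proof (intro conjI allI impI)
    fix \<epsilon> :: real assume "0 < \<epsilon>"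
    then obtain \<delta> where \<delta>: "0 < \<delta>"
      "\<And>f x y. \<lbrakk>f \<in> polar; x \<in> B; y \<in> B; 1 - \<delta> < f x; 1 - \<delta> < f y\<rbrakk> \<Longrightarrow> vnorm E (vdiff x y) < \<epsilon> / 2"
      using slice_diameter[of "\<epsilon> / 2"] by auto
    obtain M where M: "e M < \<delta> / 2"
      using order_tendstoD(2)[OF e_lim, of "\<delta> / 2"] \<delta>(1) by (auto simp: eventually_sequentially)
    have "vdist E (x m) (x n) < \<epsilon>" if mn: "M \<le> m" "M \<le> n" for m n
    proof -
      \<comment> \<open>\<open>F\<close> exceeds \<open>2 * (1 - e M)\<close> at the sum of the two
        functionals, so the sum nearly attains 2 at some y in \<open>B\<close>. Each summand is at
        most 1 there, hence y lies in both slices and links \<open>x m\<close> to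
        \<open>x n\<close>.\<close>
      define g where "g = vadd ?D (f m) (f n)"
      have "2 * (1 - e M) < F g"
        using f(2)[of m] f(2)[of n] e_mono[OF mn(1)] e_mono[OF mn(2)] by (simp add: g_def Fadd fD)
      then obtain y where y: "y \<in> B" "2 * (1 - e M) < g y"
        using norming[of g "2 * (1 - e M)"] e[of M] by (auto simp: g_def fD dual_add_closed)
      have s: "2 - 2 * e M < f m y + f n y"
        using y by (simp add: g_def dual_add_closed fD bodyD)
      have 1: "vnorm E (vdiff (x m) y) < \<epsilon> / 2"
        using s polarD(2)[OF f(1) y(1), of n] M x(2)[of m] e_mono[OF mn(1)] e[of M]
        by (intro \<delta>(2)[of "f m"] f x y) auto
      have 2: "vnorm E (vdiff y (x n)) < \<epsilon> / 2"
        using s polarD(2)[OF f(1) y(1), of m] M x(2)[of n] e_mono[OF mn(2)] e[of M]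
        by (intro \<delta>(2)[of "f n"] f x y) auto
      show ?thesis
        using 1 2 vnorm_vdiff_triangle[of "x m" y "x n"] y by (simp add: vdist_eq xE bodyD)
    qed
    then show "\<exists>N. \<forall>n n'. N \<le> n \<longrightarrow> N \<le> n' \<longrightarrow> vdist E (x n) (x n') < \<epsilon>" by blast
  qed (use xE in auto)
  then obtain l where l: "limitin metric.mtopology x l sequentially"
    using complete by (auto simp: metric.mcomplete_def)
  then have lE: "l \<in> vecs E" by (simp add: metric.limitin_metric)
  have R: "0 \<le> R" using body_bounded[OF x(1)] norm_nonneg[OF xE] by (meson order_trans)
  have le: "F g \<le> g l" if g: "g \<in> vecs ?D" for g
  proof -
    obtain C where C: "0 \<le> C" "\<And>x. x \<in> vecs E \<Longrightarrow> \<bar>g x\<bar> \<le> C * vnorm E x"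
      using dual_bounded[OF g] by blast
    have le\<epsilon>: "F g - g l \<le> (1 + 2 * C) * \<epsilon>" if \<epsilon>: "0 < \<epsilon>" for \<epsilon>
    proof -
      obtain \<delta> where \<delta>: "0 < \<delta>"
        "\<And>f x y. \<lbrakk>f \<in> polar; x \<in> B; y \<in> B; 1 - \<delta> < f x; 1 - \<delta> < f y\<rbrakk> \<Longrightarrow> vnorm E (vdiff x y) < \<epsilon>"
        using slice_diameter[OF \<epsilon>] by auto
      \<comment> \<open>On \<open>B\<close> the values of t g differ from t F g by at most t b. The
        two bounds on t b keep \<open>f n y\<close> within \<delta> of 1 and the threshold
        \<open>r\<close> below positive.\<close>
      define b where "b = C * R + \<bar>F g\<bar> + 1"
      have b: "0 < b" using C R by (simp add: b_def add_nonneg_pos)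
      define t where "t = min \<delta> 1 / (2 * b)"
      have t: "0 < t" "t * b \<le> \<delta> / 2" "t * b \<le> 1 / 2"
        using \<delta>(1) b by (auto simp: t_def)
      have tF: "t * \<bar>F g\<bar> \<le> t * b" "t * (C * R + \<bar>F g\<bar>) \<le> t * b"
        using t(1) C R by (simp_all add: b_def)
      have "\<forall>\<^sub>F n in sequentially. e n < min (\<delta> / 2) (min (1 / 4) (\<epsilon> * t))"
        using \<delta>(1) t(1) \<epsilon> by (intro order_tendstoD(2)[OF e_lim]) simp
      moreover have "\<forall>\<^sub>F n in sequentially. x n \<in> vecs E \<and> vdist E (x n) l < \<epsilon>"
        using l \<epsilon> by (simp add: metric.limitin_metric)
      ultimately have ev: "\<forall>\<^sub>F n in sequentially. e n < min (\<delta> / 2) (min (1 / 4) (\<epsilon> * t))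
          \<and> x n \<in> vecs E \<and> vdist E (x n) l < \<epsilon>"
        by (rule eventually_conj)
      obtain n where n: "e n < \<delta> / 2" "e n < 1 / 4" "e n < \<epsilon> * t" "vdist E (x n) l < \<epsilon>"
        using eventually_happens[OF ev] by auto
      define h where "h = vadd ?D (f n) (vscale ?D t g)"
      have h: "h \<in> vecs ?D" "F h = F (f n) + t * F g"
        "\<And>x. x \<in> vecs E \<Longrightarrow> h x = f n x + t * g x"
        by (simp_all add: h_def dual_add_closed dual_scale_closed fD g Fadd Fscale)
      define r where "r = 1 - e n + t * F g"
      have abs_tF: "\<bar>t * F g\<bar> = t * \<bar>F g\<bar>" using t(1) by (simp add: abs_mult)
      have "0 < r" "r < F h"
        using f(2)[of n] h(2) n(2) t(3) tF(1) abs_tF abs_ge_minus_self[of "t * F g"]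
        by (simp_all add: r_def)
      then obtain y where y: "y \<in> B" "r < h y" using norming[OF h(1)] by blast
      have hy: "h y = f n y + t * g y" using h(3) y bodyD by blast
      have gy: "\<bar>g y\<bar> \<le> C * R"
        using C(2)[OF bodyD[OF y(1)]] mult_left_mono[OF body_bounded[OF y(1)] C(1)] by simp
      have "t * g y - t * F g \<le> t * (C * R + \<bar>F g\<bar>)"
        using t(1) gy by (simp add: right_diff_distrib[symmetric])
      then have "1 - \<delta> < f n y"
        using y(2) hy r_def n(1) tF(2) t(2) by linarith
      then have "vnorm E (vdiff y (x n)) < \<epsilon>"
        using x(2)[of n] n(1) \<delta>(1) by (intro \<delta>(2)[of "f n"] f x y) auto
      moreover have "vnorm E (vdiff (x n) l) < \<epsilon>"
        using n(4) by (simp add: vdist_eq xE lE)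
      ultimately have yl: "vnorm E (vdiff y l) \<le> 2 * \<epsilon>"
        using vnorm_vdiff_triangle[OF bodyD[OF y(1)] xE lE, of n] by simp
      have "g y - g l \<le> C * (2 * \<epsilon>)"
        using C(2)[of "vdiff y l"] mult_left_mono[OF yl C(1)]
        by (simp add: dual_vdiff g lE y bodyD vdiff_closed)
      \<comment> \<open>From \<open>r < f n y + t * g y\<close> and \<open>f n y \<le> 1\<close>
        follows \<open>t * (F g - g y) < e n\<close>. Division by t costs a factor 1 / t, which is
        why \<open>e n\<close> was taken below \<open>\<epsilon> * t\<close>.\<close>
      moreover have "t * (F g - g y) < t * \<epsilon>"
        using y(2) hy r_def polarD(2)[OF f(1) y(1), of n] n(3) by (simp add: algebra_simps)
      then have "F g - g y < \<epsilon>" using t(1) by simp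
      ultimately show ?thesis by (simp add: algebra_simps)
    qed
    have "F g - g l \<le> 0 + \<epsilon>" if "0 < \<epsilon>" for \<epsilon>
      using le\<epsilon>[of "\<epsilon> / (1 + 2 * C)"] that C(1) by simp
    then show ?thesis using field_le_epsilon[of "F g - g l" 0] by simp
  qed
  have "F g = g l" if g: "g \<in> vecs ?D" for g
    using le[OF g] le[OF dual_scale_closed(1)[OF g], of "- 1"] g lE
    by (simp add: Fscale dual_scale_closed)
  then show thesis using that lE by blast
qed

text \<open>\<open>K\<close> is the size of \<open>F\<close> measured on the polar, and
  \<open>upper\<close> is its homogeneous form. Read contrapositively, \<open>upper\<close> is the
  norming property of F / K, while approximation from the polar is the definition of the supremum.
  Multiplying the representing point by \<open>K\<close> undoes the normalization; when
  \<open>K \<le> 0\<close>, applying \<open>upper\<close> to a functional and its negative gives F =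
  0.\<close>

theorem reflexive: "reflexive_space E"
  unfolding reflexive_space_def
proof (intro equalityI subsetI)
  let ?D = "dual_space E"
  fix F assume F: "F \<in> vecs (dual_space ?D)"
  have Fscale: "F (vscale ?D t f) = t * F f" if "f \<in> vecs ?D" for f t
    using F that by (simp add: dual_space_def[of ?D])
  have Fext: "F \<in> extensional (vecs ?D)" using F by (simp add: dual_space_def[of ?D])
  obtain C where C: "\<And>f. f \<in> vecs ?D \<Longrightarrow> \<bar>F f\<bar> \<le> C * vnorm ?D f"
    using F unfolding dual_space_def[of ?D] by simp blast
  define K where "K = (SUP f\<in>polar. F f)"
  have bdd: "bdd_above (F ` polar)"
  proof (intro bdd_aboveI2)
    fix f assume f: "f \<in> polar"
    have "F f \<le> \<bar>C\<bar> * vnorm ?D f"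
      using C[OF polarD(1)[OF f]] mult_right_mono[OF abs_ge_self[of C] dual_norm_nonneg[OF polarD(1)[OF f]]]
      by simp
    also have "\<dots> \<le> \<bar>C\<bar> * (1 / c)"
      using polar_dual_norm_le[OF f] by (rule mult_left_mono) simp
    finally show "F f \<le> \<bar>C\<bar> * (1 / c)" .
  qed
  have zero_polar: "vzero ?D \<in> polar"
    using bodyD by (auto simp: polar_def dual_space_def add_closed scale_closed intro!: exI[of _ 0])
  have upper: "F f \<le> K * m" if f: "f \<in> vecs ?D" and m: "0 < m" "\<And>x. x \<in> B \<Longrightarrow> f x \<le> m" for f m
  proof -
    have "vscale ?D (1 / m) f \<in> polar"
      using f m by (auto simp: polar_def dual_scale_closed bodyD)
    from cSUP_upper[OF this bdd] show ?thesis
      using m(1) by (simp add: K_def[symmetric] Fscale f field_simps)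
  qed
  show "F \<in> bidual_embedding E ` vecs E"
  proof -
    have "\<exists>x\<in>vecs E. \<forall>g\<in>vecs ?D. F g = g x"
    proof (cases "K \<le> 0")
      case True
      have le0: "F f \<le> 0" if f: "f \<in> vecs ?D" for f
      proof -
        obtain b where b: "0 \<le> b" "\<And>x. x \<in> vecs E \<Longrightarrow> \<bar>f x\<bar> \<le> b * vnorm E x"
          using dual_bounded[OF f] by blast
        \<comment> \<open>The added 1 makes the bound strictly positive, as rescaling
          \<open>f\<close> into the polar requires.\<close>
        have "f x \<le> b * \<bar>R\<bar> + 1" if "x \<in> B" for x
          using b(2)[OF bodyD[OF that]] abs_ge_self[of "f x"]
            mult_left_mono[OF order_trans[OF body_bounded[OF that] abs_ge_self] b(1)]
          by linarith
        from upper[OF f _ this] have "F f \<le> K * (b * \<bar>R\<bar> + 1)" using b(1) by (simp add: add_nonneg_pos)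
        also have "\<dots> \<le> 0" using True b(1) by (simp add: mult_nonpos_nonneg)
        finally show ?thesis .
      qed
      have "F g = g (vzero E)" if g: "g \<in> vecs ?D" for g
        using le0[OF g] le0[OF dual_scale_closed(1)[OF g], of "- 1"] g
          dual_scale[OF g zero_closed, of 0] dual_add[OF g zero_closed zero_closed]
        by (simp add: Fscale add_zero zero_closed)
      then show ?thesis using zero_closed by blast
    next
      case False
      define G where "G = vscale (dual_space ?D) (1 / K) F"
      have G_eq: "G f = F f / K" if "f \<in> vecs ?D" for f
        using that by (simp add: G_def dual_space_def[of ?D])
      have "G \<in> vecs (dual_space ?D)"
      proof -
        have "\<bar>F f\<bar> / \<bar>K\<bar> \<le> (C / \<bar>K\<bar>) * vnorm ?D f" if "f \<in> vecs ?D" for f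
          using divide_right_mono[OF C[OF that], of "\<bar>K\<bar>"] by simp
        then show ?thesis
          using F unfolding G_def dual_space_def[of ?D]
          by (auto simp: dual_add_closed dual_scale_closed algebra_simps add_divide_distrib
              intro!: exI[of _ "C / \<bar>K\<bar>"])
      qed
      moreover have "\<exists>x\<in>B. r < f x" if f: "f \<in> vecs ?D" and r: "0 < r" "r < G f" for f r
      proof (rule ccontr)
        assume "\<not> ?thesis"
        then have "F f \<le> K * r" using r(1) by (intro upper[OF f]) auto
        then show False using r(2) False by (simp add: G_eq f field_simps)
      qed
      moreover have "\<exists>f\<in>polar. r < G f" if "r < 1" for r
      proof -
        have "r * K < K" using that False by simp
        then obtain f where "f \<in> polar" "r * K < F f"
          unfolding K_def using less_cSUP_iff[OF _ bdd] zero_polar by blast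
        then show ?thesis using False by (intro bexI[of _ f]) (simp_all add: G_eq polarD(1) field_simps)
      qed
      ultimately obtain x where x: "x \<in> vecs E" "\<And>g. g \<in> vecs ?D \<Longrightarrow> G g = g x"
        using normalized_bidual_represented[of G] by blast
      have "F g = g (vscale E K x)" if "g \<in> vecs ?D" for g
        using x(2)[OF that] False by (simp add: G_eq that dual_scale[OF that x(1)] field_simps)
      then show ?thesis using scale_closed[OF x(1)] by blast
    qed
    then obtain x where x: "x \<in> vecs E" "\<And>g. g \<in> vecs ?D \<Longrightarrow> F g = g x" by blast
    then have "F = bidual_embedding E x"
      using Fext by (auto simp: bidual_embedding_def extensional_def)
    then show ?thesis using x(1) by blast
  qed
qed (auto intro: bidual_embedding_closed)

end

section \<open>Modulars\<close>

text \<open>Superadditivity of the lower limit is Fatou's lemma for the counting measure on the two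
  points of \<open>bool\<close>.\<close>

lemma liminf_add_le_ennreal:
  fixes f g :: "nat \<Rightarrow> ennreal"
  shows "liminf f + liminf g \<le> liminf (\<lambda>n. f n + g n)"
proof -
  have "(\<integral>\<^sup>+ b. liminf (\<lambda>n. if b then f n else g n) \<partial>count_space UNIV)
      \<le> liminf (\<lambda>n. \<integral>\<^sup>+ b. (if b then f n else g n) \<partial>count_space UNIV)"
    by (rule nn_integral_liminf) simp
  then show ?thesis by (simp add: nn_integral_count_space_finite UNIV_bool add.commute)
qed

text \<open>The axioms are properties that survive both sums and pullbacks along linear maps.
  \<open>growth\<close> is a quantitative Delta_2 condition and \<open>parallelogram\<close> is
  Lamperti's inequality in integrated form. Values in [0, \<infinity>] spare a separate domain of
  finiteness.\<close>

locale modular =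
  fixes M :: "'a measure" and \<rho> :: "('a \<Rightarrow> real) \<Rightarrow> ennreal" and p :: real
  assumes p_pos: "0 < p"
    and zero: "\<rho> (\<lambda>_. 0) = 0"
    and minus: "\<rho> (\<lambda>x. - u x) = \<rho> u"
    and cong_AE: "\<lbrakk>u \<in> borel_measurable M; v \<in> borel_measurable M; AE x in M. u x = v x\<rbrakk> \<Longrightarrow> \<rho> u = \<rho> v"
    and convex: "\<lbrakk>u \<in> borel_measurable M; v \<in> borel_measurable M; 0 \<le> t; t \<le> 1\<rbrakk>
      \<Longrightarrow> \<rho> (\<lambda>x. t * u x + (1 - t) * v x) \<le> ennreal t * \<rho> u + ennreal (1 - t) * \<rho> v"
    and growth: "\<lbrakk>u \<in> borel_measurable M; 1 \<le> t\<rbrakk> \<Longrightarrow> \<rho> (\<lambda>x. t * u x) \<le> ennreal (t powr p) * \<rho> u"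
    and parallelogram: "\<lbrakk>u \<in> borel_measurable M; v \<in> borel_measurable M\<rbrakk>
      \<Longrightarrow> \<rho> (\<lambda>x. 1 / 2 * u x + 1 / 2 * v x) + \<rho> (\<lambda>x. 1 / 2 * u x - 1 / 2 * v x)
        \<le> ennreal (1 / 2) * (\<rho> u + \<rho> v)"
    and Fatou: "\<lbrakk>\<And>n. w n \<in> borel_measurable M; u \<in> borel_measurable M;
      AE x in M. (\<lambda>n. w n x) \<longlonglongrightarrow> u x\<rbrakk> \<Longrightarrow> \<rho> u \<le> liminf (\<lambda>n. \<rho> (w n))"

lemma modular_add:
  assumes "modular M \<rho> p" "modular M \<sigma> p"
  shows "modular M (\<lambda>u. \<rho> u + \<sigma> u) p"
proof -
  interpret \<rho>: modular M \<rho> p by fact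
  interpret \<sigma>: modular M \<sigma> p by fact
  show ?thesis
  proof
    show "0 < p" by (rule \<rho>.p_pos)
    show "\<rho> (\<lambda>_. 0) + \<sigma> (\<lambda>_. 0) = 0" by (simp add: \<rho>.zero \<sigma>.zero)
    show "\<rho> (\<lambda>x. - u x) + \<sigma> (\<lambda>x. - u x) = \<rho> u + \<sigma> u" for u by (simp add: \<rho>.minus \<sigma>.minus)
    fix u v :: "'a \<Rightarrow> real" and t :: real
    assume m: "u \<in> borel_measurable M"
    { assume "v \<in> borel_measurable M" "AE x in M. u x = v x"
      then show "\<rho> u + \<sigma> u = \<rho> v + \<sigma> v" using \<rho>.cong_AE[OF m] \<sigma>.cong_AE[OF m] by metis }
    { assume "v \<in> borel_measurable M" "0 \<le> t" "t \<le> 1"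
      then show "\<rho> (\<lambda>x. t * u x + (1 - t) * v x) + \<sigma> (\<lambda>x. t * u x + (1 - t) * v x)
          \<le> ennreal t * (\<rho> u + \<sigma> u) + ennreal (1 - t) * (\<rho> v + \<sigma> v)"
        using add_mono[OF \<rho>.convex \<sigma>.convex, of u v t u v t] m by (simp add: distrib_left ac_simps) }
    { assume "1 \<le> t"
      then show "\<rho> (\<lambda>x. t * u x) + \<sigma> (\<lambda>x. t * u x) \<le> ennreal (t powr p) * (\<rho> u + \<sigma> u)"
        using add_mono[OF \<rho>.growth \<sigma>.growth, of u t u t] m by (simp add: distrib_left) }
    { assume "v \<in> borel_measurable M"
      then show "\<rho> (\<lambda>x. 1 / 2 * u x + 1 / 2 * v x) + \<sigma> (\<lambda>x. 1 / 2 * u x + 1 / 2 * v x)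
          + (\<rho> (\<lambda>x. 1 / 2 * u x - 1 / 2 * v x) + \<sigma> (\<lambda>x. 1 / 2 * u x - 1 / 2 * v x))
          \<le> ennreal (1 / 2) * (\<rho> u + \<sigma> u + (\<rho> v + \<sigma> v))"
        using add_mono[OF \<rho>.parallelogram \<sigma>.parallelogram, of u v u v] m
        by (simp add: distrib_left ac_simps) }
    { fix w :: "nat \<Rightarrow> 'a \<Rightarrow> real"
      assume w: "\<And>n. w n \<in> borel_measurable M" "AE x in M. (\<lambda>n. w n x) \<longlonglongrightarrow> u x"
      have "\<rho> u + \<sigma> u \<le> liminf (\<lambda>n. \<rho> (w n)) + liminf (\<lambda>n. \<sigma> (w n))"
        by (intro add_mono \<rho>.Fatou \<sigma>.Fatou w m)
      also have "\<dots> \<le> liminf (\<lambda>n. \<rho> (w n) + \<sigma> (w n))" by (rule liminf_add_le_ennreal)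
      finally show "\<rho> u + \<sigma> u \<le> liminf (\<lambda>n. \<rho> (w n) + \<sigma> (w n))" . }
  qed
qed

text \<open>For the double integral \<open>D\<close> is the difference quotient on pairs; for the
  other two terms \<open>D\<close> is the identity and only the measure changes.\<close>

lemma modular_pullback:
  fixes D :: "('a \<Rightarrow> real) \<Rightarrow> ('b \<Rightarrow> real)"
  assumes "modular M' \<rho> p"
    and D_measurable: "\<And>u. u \<in> borel_measurable M \<Longrightarrow> D u \<in> borel_measurable M'"
    and D_linear: "\<And>a b u v. D (\<lambda>x. a * u x + b * v x) = (\<lambda>z. a * D u z + b * D v z)"
    and D_continuous: "\<And>w u. AE x in M. (\<lambda>n. w n x) \<longlonglongrightarrow> u x
      \<Longrightarrow> AE z in M'. (\<lambda>n. D (w n) z) \<longlonglongrightarrow> D u z"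
  shows "modular M (\<lambda>u. \<rho> (D u)) p"
proof -
  interpret \<rho>: modular M' \<rho> p by fact
  have D_scale: "D (\<lambda>x. t * u x) = (\<lambda>z. t * D u z)" for t u
    using D_linear[of t u 0 u] by simp
  show ?thesis
  proof
    show "0 < p" by (rule \<rho>.p_pos)
    show "\<rho> (D (\<lambda>_. 0)) = 0" using D_scale[of 0] by (simp add: \<rho>.zero)
    show "\<rho> (D (\<lambda>x. - u x)) = \<rho> (D u)" for u
      using D_scale[of "-1" u] by (simp add: \<rho>.minus)
    fix u v :: "'a \<Rightarrow> real" and t :: real
    assume m: "u \<in> borel_measurable M"
    { assume v: "v \<in> borel_measurable M" "AE x in M. u x = v x"
      \<comment> \<open>The constant sequence u converges almost everywhere to v, so
        \<open>D_continuous\<close> also yields compatibility with equality almost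
        everywhere.\<close>
      have "AE z in M'. D u z = D v z"
        using D_continuous[of "\<lambda>_. u" v] v(2) by (simp add: LIMSEQ_const_iff)
      then show "\<rho> (D u) = \<rho> (D v)" by (intro \<rho>.cong_AE D_measurable m v) }
    { assume "v \<in> borel_measurable M" "0 \<le> t" "t \<le> 1"
      then show "\<rho> (D (\<lambda>x. t * u x + (1 - t) * v x)) \<le> ennreal t * \<rho> (D u) + ennreal (1 - t) * \<rho> (D v)"
        unfolding D_linear by (intro \<rho>.convex D_measurable m) }
    { assume "1 \<le> t"
      then show "\<rho> (D (\<lambda>x. t * u x)) \<le> ennreal (t powr p) * \<rho> (D u)"
        unfolding D_scale by (intro \<rho>.growth D_measurable m) }
    { assume "v \<in> borel_measurable M"
      then show "\<rho> (D (\<lambda>x. 1 / 2 * u x + 1 / 2 * v x)) + \<rho> (D (\<lambda>x. 1 / 2 * u x - 1 / 2 * v x))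
          \<le> ennreal (1 / 2) * (\<rho> (D u) + \<rho> (D v))"
        using D_linear[of "1/2" u "1/2" v] D_linear[of "1/2" u "-1/2" v]
          \<rho>.parallelogram[OF D_measurable D_measurable, of u v] m by simp }
    { fix w :: "nat \<Rightarrow> 'a \<Rightarrow> real"
      assume w: "\<And>n. w n \<in> borel_measurable M" "AE x in M. (\<lambda>n. w n x) \<longlonglongrightarrow> u x"
      show "\<rho> (D u) \<le> liminf (\<lambda>n. \<rho> (D (w n)))"
        by (intro \<rho>.Fatou D_measurable D_continuous w m) }
  qed
qed

section \<open>Musielak--Orlicz modulars\<close>

text \<open>The measure \<open>M\<close> is meant to carry the weight, be it the singular kernel, an
  indicator or \<beta>. \<open>growth\<close> is the integrated form of the upper exponent
  bound.\<close>

locale musielak =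
  fixes M :: "'z measure" and \<Psi> :: "'z \<Rightarrow> real \<Rightarrow> real" and p :: real
  assumes exponent_pos: "0 < p"
    and measurable: "0 \<le> t \<Longrightarrow> (\<lambda>z. \<Psi> z t) \<in> borel_measurable M"
    and continuous: "continuous_on {0..} (\<Psi> z)"
    and convex: "convex_on {0..} (\<Psi> z)"
    and mono: "\<lbrakk>0 \<le> r; r \<le> t\<rbrakk> \<Longrightarrow> \<Psi> z r \<le> \<Psi> z t"
    and zero: "\<Psi> z 0 = 0"
    and pos: "0 < t \<Longrightarrow> 0 < \<Psi> z t"
    and growth: "\<lbrakk>1 \<le> r; 0 \<le> t\<rbrakk> \<Longrightarrow> \<Psi> z (r * t) \<le> r powr p * \<Psi> z t"
    and convex_sqrt: "convex_on {0..} (\<lambda>t. \<Psi> z (sqrt t))"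
begin

definition integral_modular :: "('z \<Rightarrow> real) \<Rightarrow> ennreal" where
  "integral_modular v = (\<integral>\<^sup>+ z. ennreal (\<Psi> z \<bar>v z\<bar>) \<partial>M)"

lemma nonneg: "0 \<le> t \<Longrightarrow> 0 \<le> \<Psi> z t"
  using mono[of 0 t z] by (simp add: zero)

lemma tendsto_abs:
  assumes "f \<longlonglongrightarrow> l"
  shows "(\<lambda>n. \<Psi> z \<bar>f n\<bar>) \<longlonglongrightarrow> \<Psi> z \<bar>l\<bar>"
  using assms by (intro continuous_on_tendsto_compose[OF continuous] tendsto_rabs) auto

text \<open>\<Psi> is a Caratheodory function. Rounding |v| down to the grid of mesh 1 / (n + 1)
  leaves countably many values, and for each of them \<Psi> is measurable at a fixed argument;
  continuity in the second variable gives the limit.\<close>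

lemma measurable_superposition:
  assumes v[measurable]: "v \<in> borel_measurable M"
  shows "(\<lambda>z. \<Psi> z \<bar>v z\<bar>) \<in> borel_measurable M"
proof (rule borel_measurable_LIMSEQ_real)
  define q where "q n z = of_int \<lfloor>\<bar>v z\<bar> * real (Suc n)\<rfloor> / real (Suc n)" for n z
  show "(\<lambda>z. \<Psi> z \<bar>q n z\<bar>) \<in> borel_measurable M" for n
  proof -
    have "(\<lambda>z. \<Psi> z \<bar>of_int \<lfloor>\<bar>v z\<bar> * real (Suc n)\<rfloor> / real (Suc n)\<bar>) \<in> borel_measurable M"
      by (rule measurable_compose_countable[where g = "\<lambda>z. \<lfloor>\<bar>v z\<bar> * real (Suc n)\<rfloor>"
            and f = "\<lambda>k z. \<Psi> z \<bar>of_int k / real (Suc n)\<bar>"])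
        (auto intro: measurable)
    then show ?thesis by (simp add: q_def)
  qed
  show "(\<lambda>n. \<Psi> z \<bar>q n z\<bar>) \<longlonglongrightarrow> \<Psi> z \<bar>v z\<bar>" for z
  proof -
    have "(\<lambda>n. q n z) \<longlonglongrightarrow> \<bar>v z\<bar>"
    proof (rule tendsto_sandwich)
      show "(\<lambda>n. \<bar>v z\<bar> - 1 / real (Suc n)) \<longlonglongrightarrow> \<bar>v z\<bar>"
        using tendsto_diff[OF tendsto_const LIMSEQ_inverse_real_of_nat, of "\<bar>v z\<bar>"]
        by (simp add: inverse_eq_divide)
      show "\<forall>\<^sub>F n in sequentially. \<bar>v z\<bar> - 1 / real (Suc n) \<le> q n z"
      proof (intro always_eventually allI)
        fix n
        have "\<bar>v z\<bar> * real (Suc n) - 1 \<le> of_int \<lfloor>\<bar>v z\<bar> * real (Suc n)\<rfloor>" by linarith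
        then have "\<bar>v z\<bar> \<le> (of_int \<lfloor>\<bar>v z\<bar> * real (Suc n)\<rfloor> + 1) / real (Suc n)"
          by (subst pos_le_divide_eq) auto
        then show "\<bar>v z\<bar> - 1 / real (Suc n) \<le> q n z"
          by (simp add: q_def add_divide_distrib)
      qed
      show "\<forall>\<^sub>F n in sequentially. q n z \<le> \<bar>v z\<bar>"
      proof (intro always_eventually allI)
        fix n
        have "of_int \<lfloor>\<bar>v z\<bar> * real (Suc n)\<rfloor> \<le> \<bar>v z\<bar> * real (Suc n)" by linarith
        then show "q n z \<le> \<bar>v z\<bar>"
          unfolding q_def by (subst pos_divide_le_eq) auto
      qed
    qed simp
    from tendsto_abs[OF this, of z] show ?thesis by simp
  qed
qed

lemma convex_le:
  assumes "0 \<le> a" "0 \<le> b" "0 \<le> t" "t \<le> 1"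
  shows "\<Psi> z (t * a + (1 - t) * b) \<le> t * \<Psi> z a + (1 - t) * \<Psi> z b"
  using convex_onD[OF convex, of "1 - t" a b z] assms by simp

text \<open>
  Lamperti's inequality: \<open>A t = \<Psi> z (sqrt t)\<close> is convex with \<open>A 0 = 0\<close>, hence superadditive, so
  the left-hand side is at most \<open>A ((a\<^sup>2 + b\<^sup>2) / 2)\<close>.
\<close>

lemma Lamperti:
  "\<Psi> z \<bar>1 / 2 * a + 1 / 2 * b\<bar> + \<Psi> z \<bar>1 / 2 * a - 1 / 2 * b\<bar> \<le> 1 / 2 * (\<Psi> z \<bar>a\<bar> + \<Psi> z \<bar>b\<bar>)"
proof -
  define A where "A t = \<Psi> z (sqrt t)" for t
  have A: "A (t * x + (1 - t) * y) \<le> t * A x + (1 - t) * A y"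
    if "0 \<le> x" "0 \<le> y" "0 \<le> t" "t \<le> 1" for x y t
    using convex_onD[OF convex_sqrt, of "1 - t" x y z] that by (simp add: A_def)
  have A0: "A 0 = 0" by (simp add: A_def zero)
  have abs: "\<Psi> z \<bar>x\<bar> = A (x\<^sup>2)" for x by (simp add: A_def)
  have super: "A x + A y \<le> A (x + y)" if "0 \<le> x" "0 \<le> y" for x y
  proof (cases "x + y = 0")
    case True
    then show ?thesis using that A0 by (simp add: add_nonneg_eq_0_iff)
  next
    case False
    then have s: "0 < x + y" using that by simp
    have "A x \<le> x / (x + y) * A (x + y)" "A y \<le> y / (x + y) * A (x + y)"
      using A[of "x + y" 0 "x / (x + y)"] A[of "x + y" 0 "y / (x + y)"] that s A0 by simp_all
    then have "A x + A y \<le> (x / (x + y) + y / (x + y)) * A (x + y)"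
      by (simp add: distrib_right)
    also have "x / (x + y) + y / (x + y) = 1" using s by (simp add: add_divide_distrib[symmetric])
    finally show ?thesis by simp
  qed
  have "A ((1 / 2 * a + 1 / 2 * b)\<^sup>2) + A ((1 / 2 * a - 1 / 2 * b)\<^sup>2)
      \<le> A ((1 / 2 * a + 1 / 2 * b)\<^sup>2 + (1 / 2 * a - 1 / 2 * b)\<^sup>2)"
    by (rule super) simp_all
  also have "(1 / 2 * a + 1 / 2 * b)\<^sup>2 + (1 / 2 * a - 1 / 2 * b)\<^sup>2 = 1 / 2 * a\<^sup>2 + (1 - 1 / 2) * b\<^sup>2"
    by (simp add: power2_eq_square field_simps)
  also have "A \<dots> \<le> 1 / 2 * A (a\<^sup>2) + (1 - 1 / 2) * A (b\<^sup>2)"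
    by (rule A) simp_all
  finally show ?thesis by (simp add: abs)
qed

lemma modular_integral_modular: "modular M integral_modular p"
proof
  note [measurable] = measurable_superposition
  show "0 < p" by (rule exponent_pos)
  show "integral_modular (\<lambda>_. 0) = 0" by (simp add: integral_modular_def zero)
  show "integral_modular (\<lambda>x. - u x) = integral_modular u" for u
    by (simp add: integral_modular_def)
  fix u v :: "'z \<Rightarrow> real" and t :: real
  assume m[measurable]: "u \<in> borel_measurable M"
  { assume "AE x in M. u x = v x"
    then show "integral_modular u = integral_modular v"
      unfolding integral_modular_def by (intro nn_integral_cong_AE) auto }
  { assume [measurable]: "v \<in> borel_measurable M" and t: "0 \<le> t" "t \<le> 1"
    have "integral_modular (\<lambda>x. t * u x + (1 - t) * v x)
        \<le> (\<integral>\<^sup>+ z. ennreal t * ennreal (\<Psi> z \<bar>u z\<bar>) + ennreal (1 - t) * ennreal (\<Psi> z \<bar>v z\<bar>) \<partial>M)"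
      unfolding integral_modular_def
    proof (rule nn_integral_mono)
      fix z
      have "\<bar>t * u z + (1 - t) * v z\<bar> \<le> t * \<bar>u z\<bar> + (1 - t) * \<bar>v z\<bar>"
        using abs_triangle_ineq[of "t * u z" "(1 - t) * v z"] t by (simp add: abs_mult)
      then have "\<Psi> z \<bar>t * u z + (1 - t) * v z\<bar> \<le> \<Psi> z (t * \<bar>u z\<bar> + (1 - t) * \<bar>v z\<bar>)"
        by (intro mono) auto
      also have "\<dots> \<le> t * \<Psi> z \<bar>u z\<bar> + (1 - t) * \<Psi> z \<bar>v z\<bar>" using t by (intro convex_le) auto
      finally show "ennreal (\<Psi> z \<bar>t * u z + (1 - t) * v z\<bar>)
          \<le> ennreal t * ennreal (\<Psi> z \<bar>u z\<bar>) + ennreal (1 - t) * ennreal (\<Psi> z \<bar>v z\<bar>)"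
        using t by (simp add: ennreal_mult[symmetric] ennreal_plus[symmetric] nonneg ennreal_leI
            del: ennreal_plus)
    qed
    also have "\<dots> = ennreal t * integral_modular u + ennreal (1 - t) * integral_modular v"
      unfolding integral_modular_def by (simp add: nn_integral_add nn_integral_cmult)
    finally show "integral_modular (\<lambda>x. t * u x + (1 - t) * v x)
        \<le> ennreal t * integral_modular u + ennreal (1 - t) * integral_modular v" . }
  { assume t: "1 \<le> t"
    have "integral_modular (\<lambda>x. t * u x) \<le> (\<integral>\<^sup>+ z. ennreal (t powr p) * ennreal (\<Psi> z \<bar>u z\<bar>) \<partial>M)"
      unfolding integral_modular_def using t growth[of t]
      by (intro nn_integral_mono) (simp add: abs_mult ennreal_mult'[symmetric] ennreal_leI)
    also have "\<dots> = ennreal (t powr p) * integral_modular u"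
      unfolding integral_modular_def by (simp add: nn_integral_cmult)
    finally show "integral_modular (\<lambda>x. t * u x) \<le> ennreal (t powr p) * integral_modular u" . }
  { assume [measurable]: "v \<in> borel_measurable M"
    have "integral_modular (\<lambda>x. 1 / 2 * u x + 1 / 2 * v x) + integral_modular (\<lambda>x. 1 / 2 * u x - 1 / 2 * v x)
      = (\<integral>\<^sup>+ z. ennreal (\<Psi> z \<bar>1 / 2 * u z + 1 / 2 * v z\<bar>) + ennreal (\<Psi> z \<bar>1 / 2 * u z - 1 / 2 * v z\<bar>) \<partial>M)"
      unfolding integral_modular_def by (intro nn_integral_add[symmetric]) measurable
    also have "\<dots> \<le> (\<integral>\<^sup>+ z. ennreal (1 / 2) * (ennreal (\<Psi> z \<bar>u z\<bar>) + ennreal (\<Psi> z \<bar>v z\<bar>)) \<partial>M)"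
    proof (rule nn_integral_mono)
      fix z
      show "ennreal (\<Psi> z \<bar>1 / 2 * u z + 1 / 2 * v z\<bar>) + ennreal (\<Psi> z \<bar>1 / 2 * u z - 1 / 2 * v z\<bar>)
          \<le> ennreal (1 / 2) * (ennreal (\<Psi> z \<bar>u z\<bar>) + ennreal (\<Psi> z \<bar>v z\<bar>))"
        using ennreal_leI[OF Lamperti[of z "u z" "v z"]]
        by (simp add: ennreal_mult' ennreal_plus nonneg del: times_divide_eq_left)
    qed
    also have "\<dots> = ennreal (1 / 2) * (integral_modular u + integral_modular v)"
      unfolding integral_modular_def by (simp add: nn_integral_add nn_integral_cmult)
    finally show "integral_modular (\<lambda>x. 1 / 2 * u x + 1 / 2 * v x) + integral_modular (\<lambda>x. 1 / 2 * u x - 1 / 2 * v x)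
        \<le> ennreal (1 / 2) * (integral_modular u + integral_modular v)" . }
  { fix w :: "nat \<Rightarrow> 'z \<Rightarrow> real"
    assume [measurable]: "\<And>n. w n \<in> borel_measurable M" and lim: "AE x in M. (\<lambda>n. w n x) \<longlonglongrightarrow> u x"
    have "integral_modular u = (\<integral>\<^sup>+ z. liminf (\<lambda>n. ennreal (\<Psi> z \<bar>w n z\<bar>)) \<partial>M)"
      unfolding integral_modular_def
    proof (rule nn_integral_cong_AE, use lim in eventually_elim)
      case (elim z)
      then have "(\<lambda>n. ennreal (\<Psi> z \<bar>w n z\<bar>)) \<longlonglongrightarrow> ennreal (\<Psi> z \<bar>u z\<bar>)"
        by (intro tendsto_ennrealI tendsto_abs)
      then show ?case by (simp add: lim_imp_Liminf)
    qed
    also have "\<dots> \<le> liminf (\<lambda>n. integral_modular (w n))"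
      unfolding integral_modular_def by (rule nn_integral_liminf) measurable
    finally show "integral_modular u \<le> liminf (\<lambda>n. integral_modular (w n))" . }
qed

text \<open>The integrals are summable, so for almost every z the values of \<Psi> at the increments
  scaled by 2^n tend to 0. Once they are below \<open>\<Psi> z 1\<close>, monotonicity bounds the
  n-th increment by 2^(-n), and the increments are summable. The factor 2^n is what yields a rate
  independent of how \<Psi> behaves near 0 at the given z.\<close>

lemma AE_convergent:
  assumes v[measurable]: "\<And>n. v n \<in> borel_measurable M"
    and small: "\<And>n. integral_modular (\<lambda>z. 2 ^ n * (v (Suc n) z - v n z)) \<le> ennreal ((1 / 2) ^ n)"
  shows "AE z in M. convergent (\<lambda>n. v n z)"
proof -
  note [measurable] = measurable_superposition
  define f where "f n z = ennreal (\<Psi> z \<bar>2 ^ n * (v (Suc n) z - v n z)\<bar>)" for n z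
  have [measurable]: "f n \<in> borel_measurable M" for n unfolding f_def by measurable
  have "(\<integral>\<^sup>+ z. (\<Sum>n. f n z) \<partial>M) = (\<Sum>n. integral\<^sup>N M (f n))"
    by (rule nn_integral_suminf) simp
  also have "\<dots> \<le> (\<Sum>n. ennreal ((1 / 2) ^ n))"
    using small by (intro suminf_le) (auto simp: f_def[abs_def] integral_modular_def)
  also have "\<dots> = ennreal (\<Sum>n. (1 / 2) ^ n)"
    by (intro suminf_ennreal2) (auto intro: summable_geometric)
  finally have "(\<integral>\<^sup>+ z. (\<Sum>n. f n z) \<partial>M) \<noteq> \<infinity>" by (auto simp: top_unique)
  then have "AE z in M. (\<Sum>n. f n z) \<noteq> \<infinity>" by (intro nn_integral_PInf_AE) measurable
  then show ?thesis
  proof eventually_elim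
    case (elim z)
    have "summable (\<lambda>n. \<Psi> z \<bar>2 ^ n * (v (Suc n) z - v n z)\<bar>)"
      using elim unfolding f_def by (intro summable_suminf_not_top) (auto simp: nonneg)
    from summable_LIMSEQ_zero[OF this]
    have "\<forall>\<^sub>F n in sequentially. \<Psi> z \<bar>2 ^ n * (v (Suc n) z - v n z)\<bar> < \<Psi> z 1"
      by (rule order_tendstoD(2)) (simp add: pos)
    then have "\<forall>\<^sub>F n in sequentially. norm (v (Suc n) z - v n z) \<le> (1 / 2) ^ n"
    proof eventually_elim
      case (elim n)
      then have "\<bar>2 ^ n * (v (Suc n) z - v n z)\<bar> < 1"
        using mono[of 1 "\<bar>2 ^ n * (v (Suc n) z - v n z)\<bar>" z] by force
      then have "2 ^ n * \<bar>v (Suc n) z - v n z\<bar> < 1" by (simp only: abs_mult) simp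
      then show ?case by (simp add: power_one_over pos_le_divide_eq mult.commute)
    qed
    then have "summable (\<lambda>n. v (Suc n) z - v n z)"
      by (rule summable_comparison_test_ev) (simp add: summable_geometric)
    from summable_LIMSEQ[OF this] have "convergent (\<lambda>n. v n z - v 0 z)"
      by (auto simp: sum_lessThan_telescope[of "\<lambda>n. v n z"] convergent_def)
    then have "convergent (\<lambda>n. (v n z - v 0 z) + v 0 z)" by (intro convergent_add convergent_const)
    then show ?case by simp
  qed
qed

end

section \<open>Luxemburg gauges\<close>

context modular
begin

definition gauge :: "('a \<Rightarrow> real) \<Rightarrow> ennreal" where
  "gauge u = luxemburg (\<lambda>l. \<rho> (\<lambda>x. u x / l))"

lemma gauge_le: "\<lbrakk>0 < l; \<rho> (\<lambda>x. u x / l) \<le> 1\<rbrakk> \<Longrightarrow> gauge u \<le> ennreal l"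
  unfolding gauge_def luxemburg_def by (intro Inf_lower) auto

lemma gauge_greatest:
  "(\<And>l. \<lbrakk>0 < l; \<rho> (\<lambda>x. u x / l) \<le> 1\<rbrakk> \<Longrightarrow> c \<le> ennreal l) \<Longrightarrow> c \<le> gauge u"
  unfolding gauge_def luxemburg_def by (intro Inf_greatest) auto

lemma scale_le:
  assumes "u \<in> borel_measurable M" "0 \<le> t" "t \<le> 1"
  shows "\<rho> (\<lambda>x. t * u x) \<le> ennreal t * \<rho> u"
  using convex[of u "\<lambda>_. 0" t] assms by (simp add: zero)

text \<open>A strict inequality provides an admissible k < l, and convexity together with \<rho> 0 =
  0 carries admissibility from k up to l. This avoids asking whether the infimum is
  attained.\<close>

lemma modular_le_of_gauge_less:
  assumes u: "u \<in> borel_measurable M" and "gauge u < ennreal l"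
  shows "\<rho> (\<lambda>x. u x / l) \<le> 1"
proof -
  obtain k where k: "0 < k" "\<rho> (\<lambda>x. u x / k) \<le> 1" "ennreal k < ennreal l"
    using assms(2) unfolding gauge_def luxemburg_def Inf_less_iff by auto
  then have kl: "k < l" by (simp add: ennreal_less_iff)
  have "\<rho> (\<lambda>x. (k / l) * (u x / k)) \<le> ennreal (k / l) * \<rho> (\<lambda>x. u x / k)"
    using u k kl by (intro scale_le) auto
  also have "\<dots> \<le> 1 * 1"
    using k kl by (intro mult_mono) (auto simp: ennreal_le_1)
  finally show ?thesis using k by simp
qed

lemma gauge_zero: "gauge (\<lambda>_. 0) = 0"
proof -
  have "gauge (\<lambda>_. 0) \<le> 0"
    by (rule ennreal_le_epsilon) (simp add: gauge_le zero)
  then show ?thesis by simp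
qed

lemma gauge_cong_AE:
  assumes "u \<in> borel_measurable M" "v \<in> borel_measurable M" "AE x in M. u x = v x"
  shows "gauge u = gauge v"
proof -
  have "\<rho> (\<lambda>x. u x / l) = \<rho> (\<lambda>x. v x / l)" for l
    using assms by (intro cong_AE) auto
  then show ?thesis by (simp add: gauge_def)
qed

lemma gauge_add:
  assumes u: "u \<in> borel_measurable M" and v: "v \<in> borel_measurable M"
  shows "gauge (\<lambda>x. u x + v x) \<le> gauge u + gauge v"
proof (rule ennreal_le_epsilon)
  fix e :: real assume e: "0 < e" and "gauge u + gauge v < top"
  then obtain \<alpha> \<beta> where \<alpha>: "gauge u = ennreal \<alpha>" "0 \<le> \<alpha>" and \<beta>: "gauge v = ennreal \<beta>" "0 \<le> \<beta>"
    by (cases "gauge u" rule: ennreal_cases; cases "gauge v" rule: ennreal_cases) auto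
  define a b where "a = \<alpha> + e / 2" and "b = \<beta> + e / 2"
  have ab: "0 < a" "0 < b" using e \<alpha> \<beta> by (simp_all add: a_def b_def)
  have "gauge u < ennreal a" "gauge v < ennreal b"
    using \<alpha> \<beta> e by (simp_all add: a_def b_def ennreal_less_iff)
  then have "\<rho> (\<lambda>x. u x / a) \<le> 1" "\<rho> (\<lambda>x. v x / b) \<le> 1"
    using modular_le_of_gauge_less u v by auto
  define t where "t = a / (a + b)"
  have t: "0 \<le> t" "t \<le> 1" "1 - t = b / (a + b)" using ab by (auto simp: t_def field_simps)
  have "\<rho> (\<lambda>x. t * (u x / a) + (1 - t) * (v x / b))
      \<le> ennreal t * \<rho> (\<lambda>x. u x / a) + ennreal (1 - t) * \<rho> (\<lambda>x. v x / b)"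
    using u v t by (intro convex) auto
  also have "\<dots> \<le> ennreal t * 1 + ennreal (1 - t) * 1"
    by (intro add_mono mult_left_mono) (fact | simp)+
  also have "\<dots> = 1" using t by (simp add: ennreal_plus[symmetric] del: ennreal_plus)
  finally have "\<rho> (\<lambda>x. (u x + v x) / (a + b)) \<le> 1"
    using ab t(3) by (simp add: t_def add_divide_distrib)
  then have "gauge (\<lambda>x. u x + v x) \<le> ennreal (a + b)" using ab by (intro gauge_le) auto
  also have "\<dots> = gauge u + gauge v + ennreal e"
    using \<alpha> \<beta> e by (simp add: a_def b_def ennreal_plus[symmetric] del: ennreal_plus)
  finally show "gauge (\<lambda>x. u x + v x) \<le> gauge u + gauge v + ennreal e" .
qed

lemma gauge_minus: "gauge (\<lambda>x. - u x) = gauge u"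
proof -
  have "\<rho> (\<lambda>x. - u x / l) = \<rho> (\<lambda>x. u x / l)" for l
    using minus[of "\<lambda>x. u x / l"] by simp
  then show ?thesis by (simp add: gauge_def)
qed

lemma gauge_scale: "gauge (\<lambda>x. c * u x) = ennreal \<bar>c\<bar> * gauge u"
proof -
  \<comment> \<open>Only this inequality is proved from the infimum; the reverse one is the same
    statement for 1 / c and the function c u.\<close>
  have le: "ennreal (1 / c) * gauge (\<lambda>x. c * u x) \<le> gauge u" if c: "0 < c" for c u
  proof (rule gauge_greatest)
    fix l :: real assume l: "0 < l" "\<rho> (\<lambda>x. u x / l) \<le> 1"
    then have "gauge (\<lambda>x. c * u x) \<le> ennreal (c * l)" using c by (intro gauge_le) auto
    then have "ennreal (1 / c) * gauge (\<lambda>x. c * u x) \<le> ennreal (1 / c) * ennreal (c * l)"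
      by (rule mult_left_mono) simp
    also have "\<dots> = ennreal l" using c by (subst ennreal_mult'[symmetric]) auto
    finally show "ennreal (1 / c) * gauge (\<lambda>x. c * u x) \<le> ennreal l" .
  qed
  have pos: "gauge (\<lambda>x. c * u x) = ennreal c * gauge u" if c: "0 < c" for c u
  proof (rule antisym)
    have "ennreal c * (ennreal (1 / c) * gauge (\<lambda>x. c * u x)) \<le> ennreal c * gauge u"
      by (intro mult_left_mono le c) simp
    moreover have "ennreal c * ennreal (1 / c) = 1"
      using c by (subst ennreal_mult'[symmetric]) auto
    ultimately show "gauge (\<lambda>x. c * u x) \<le> ennreal c * gauge u"
      by (simp add: mult.assoc[symmetric])
    show "ennreal c * gauge u \<le> gauge (\<lambda>x. c * u x)"
      using le[of "1 / c" "\<lambda>x. c * u x"] c by simp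
  qed
  consider "0 < c" | "c = 0" | "0 < - c" by linarith
  then show ?thesis
  proof cases
    case 3
    then show ?thesis
      using pos[of "- c" u] gauge_minus[of "\<lambda>x. c * u x"] by simp
  qed (simp_all add: pos gauge_zero)
qed

lemma modular_le_gauge:
  assumes u: "u \<in> borel_measurable M" and "gauge u < ennreal l" "l \<le> 1"
  shows "\<rho> u \<le> ennreal l"
proof -
  have l: "0 < l" using assms(2) by (metis ennreal_less_zero_iff le_less_trans zero_le)
  have "\<rho> (\<lambda>x. l * (u x / l)) \<le> ennreal l * \<rho> (\<lambda>x. u x / l)"
    using u l assms(3) by (intro scale_le) auto
  also have "\<dots> \<le> ennreal l * 1"
    by (intro mult_left_mono modular_le_of_gauge_less assms) simp
  finally show ?thesis using l by simp
qed

text \<open>Dividing by l raises the modular by at most the factor l^(-p). With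
  \<open>modular_le_gauge\<close>, which rests on convexity alone, this shows that the modular is
  small exactly when the gauge is small.\<close>

lemma gauge_le_of_modular:
  assumes u: "u \<in> borel_measurable M" and l: "0 < l" "l \<le> 1" and "\<rho> u \<le> ennreal (l powr p)"
  shows "gauge u \<le> ennreal l"
proof (rule gauge_le)
  have "\<rho> (\<lambda>x. (1 / l) * u x) \<le> ennreal ((1 / l) powr p) * \<rho> u"
    using u l by (intro growth) auto
  also have "\<dots> \<le> ennreal ((1 / l) powr p) * ennreal (l powr p)"
    using assms(4) by (rule mult_left_mono) simp
  also have "\<dots> = 1"
    using l by (simp add: ennreal_mult'[symmetric] powr_mult[symmetric])
  finally show "\<rho> (\<lambda>x. u x / l) \<le> 1" by simp
qed (rule l)

end

section \<open>The space of classes of finite norm\<close>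

text \<open>Keeping the norm \<open>N\<close> abstract separates the handling of classes from the
  three integrals.\<close>

definition class_space :: "((real^'n \<Rightarrow> real) \<Rightarrow> ennreal) \<Rightarrow> (real^'n \<Rightarrow> real) set nspace" where
  "class_space N =
    \<lparr> vecs = {u \<in> borel_measurable lebesgue. N u < \<infinity>} // ae_rel,
      vzero = ae_rel `` {\<lambda>x. 0},
      vadd = (\<lambda>U V. \<Union>u\<in>U. \<Union>v\<in>V. ae_rel `` {\<lambda>x. u x + v x}),
      vscale = (\<lambda>c U. \<Union>u\<in>U. ae_rel `` {\<lambda>x. c * u x}),
      vnorm = (\<lambda>U. the_elem ((\<lambda>u. enn2real (N u)) ` U)) \<rparr>"

lemma X_space_eq_class_space: "X_space \<Omega> \<beta> s a = class_space (X_norm \<Omega> \<beta> s a)"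
  by (simp add: X_space_def class_space_def X_fun_def)

abbreviation ae_class :: "(real^'n \<Rightarrow> real) \<Rightarrow> (real^'n \<Rightarrow> real) set" where
  "ae_class u \<equiv> ae_rel `` {u}"

lemma mem_ae_rel_iff:
  "(u, v) \<in> ae_rel \<longleftrightarrow> u \<in> borel_measurable lebesgue \<and> v \<in> borel_measurable lebesgue \<and>
    (AE x in lebesgue. u x = v x)"
  by (simp add: ae_rel_def)

lemma ae_class_eqI:
  assumes "u \<in> borel_measurable lebesgue" "v \<in> borel_measurable lebesgue" "AE x in lebesgue. u x = v x"
  shows "ae_class u = ae_class v"
proof -
  have "(AE x in lebesgue. u x = w x) \<longleftrightarrow> (AE x in lebesgue. v x = w x)" for w
    by (rule eventually_subst, use assms(3) in eventually_elim) simp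
  then show ?thesis using assms by (auto simp: mem_ae_rel_iff)
qed

lemma ae_class_eqD:
  assumes "u \<in> borel_measurable lebesgue" "v \<in> borel_measurable lebesgue" "ae_class u = ae_class v"
  shows "AE x in lebesgue. u x = v x"
  using assms mem_ae_rel_iff[of u v] mem_ae_rel_iff[of v v] by auto

text \<open>Operations on classes are unions over representatives; when all the sets in such a union
  coincide, it is evaluated at a single representative.\<close>

lemma UN_ae_class:
  assumes "u \<in> borel_measurable lebesgue"
    and "\<And>v. \<lbrakk>v \<in> borel_measurable lebesgue; AE x in lebesgue. u x = v x\<rbrakk> \<Longrightarrow> f v = f u"
  shows "(\<Union>v\<in>ae_class u. f v) = f u"
proof -
  have "u \<in> ae_class u" using assms(1) by (simp add: mem_ae_rel_iff)
  moreover have "\<forall>v\<in>ae_class u. f v = f u"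
    by (intro ballI assms(2)) (simp_all add: mem_ae_rel_iff)
  ultimately show ?thesis by (rule UN_constant_eq)
qed

text \<open>\<open>N\<close> is the norm of the space, whereas \<open>gauge\<close> is the Luxemburg
  gauge of the total modular, to which \<open>N\<close> is only equivalent.
  \<open>AE_convergent\<close> is the point where the domain of integration matters; it supplies
  both definiteness of \<open>N\<close> and the limits for completeness.\<close>

locale complete_modular_norm = modular lebesgue \<rho> p
  for \<rho> :: "(real^'n \<Rightarrow> real) \<Rightarrow> ennreal" and p :: real +
  fixes N :: "(real^'n \<Rightarrow> real) \<Rightarrow> ennreal"
  assumes N_cong: "\<lbrakk>u \<in> borel_measurable lebesgue; v \<in> borel_measurable lebesgue;
      AE x in lebesgue. u x = v x\<rbrakk> \<Longrightarrow> N u = N v"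
    and N_add: "\<lbrakk>u \<in> borel_measurable lebesgue; v \<in> borel_measurable lebesgue\<rbrakk>
      \<Longrightarrow> N (\<lambda>x. u x + v x) \<le> N u + N v"
    and N_scale: "u \<in> borel_measurable lebesgue \<Longrightarrow> N (\<lambda>x. c * u x) = ennreal \<bar>c\<bar> * N u"
    and N_le_gauge: "u \<in> borel_measurable lebesgue \<Longrightarrow> N u \<le> 3 * gauge u"
    and gauge_le_N: "u \<in> borel_measurable lebesgue \<Longrightarrow> gauge u \<le> 3 * N u"
    and AE_convergent: "\<lbrakk>\<And>n. w n \<in> borel_measurable lebesgue;
      \<And>n. \<rho> (\<lambda>x. 2 ^ n * (w (Suc n) x - w n x)) \<le> ennreal ((1 / 2) ^ n)\<rbrakk>
      \<Longrightarrow> AE x in lebesgue. convergent (\<lambda>n. w n x)"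
begin

section \<open>Vector operations and norm on almost everywhere classes\<close>

abbreviation "E \<equiv> class_space N"

definition V where "V = {u \<in> borel_measurable lebesgue. N u < \<infinity>}"

lemma V_measurable: "u \<in> V \<Longrightarrow> u \<in> borel_measurable lebesgue"
  by (simp add: V_def)

lemma V_zero: "(\<lambda>_. 0) \<in> V"
  using N_scale[of "\<lambda>_. 0" 0] by (simp add: V_def)

lemma V_scale: "u \<in> V \<Longrightarrow> (\<lambda>x. c * u x) \<in> V"
  by (auto simp: V_def N_scale ennreal_mult_less_top)

lemma V_add: "\<lbrakk>u \<in> V; v \<in> V\<rbrakk> \<Longrightarrow> (\<lambda>x. u x + v x) \<in> V"
  using N_add[of u v] by (auto simp: V_def intro: le_less_trans)

lemma vecsE:
  assumes "U \<in> vecs E"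
  obtains u where "u \<in> V" "U = ae_class u"
  using assms by (auto simp: class_space_def V_def quotient_def)

lemma ae_class_in_vecs: "u \<in> V \<Longrightarrow> ae_class u \<in> vecs E"
  by (auto simp: class_space_def V_def quotient_def)

lemma class_zero: "vzero E = ae_class (\<lambda>_. 0)"
  by (simp add: class_space_def)

lemma class_add:
  assumes [measurable]: "u \<in> borel_measurable lebesgue" "v \<in> borel_measurable lebesgue"
  shows "vadd E (ae_class u) (ae_class v) = ae_class (\<lambda>x. u x + v x)"
proof -
  have 1: "(\<Union>v'\<in>ae_class v. ae_class (\<lambda>x. u' x + v' x)) = ae_class (\<lambda>x. u' x + v x)"
    if [measurable]: "u' \<in> borel_measurable lebesgue" for u'
  proof (rule UN_ae_class)
    fix v' assume [measurable]: "v' \<in> borel_measurable lebesgue" and "AE x in lebesgue. v x = v' x"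
    then show "ae_class (\<lambda>x. u' x + v' x) = ae_class (\<lambda>x. u' x + v x)"
      by (intro ae_class_eqI) (auto elim: eventually_mono)
  qed measurable
  have "(\<Union>u'\<in>ae_class u. \<Union>v'\<in>ae_class v. ae_class (\<lambda>x. u' x + v' x))
      = (\<Union>u'\<in>ae_class u. ae_class (\<lambda>x. u' x + v x))"
    by (intro SUP_cong refl 1) (simp add: mem_ae_rel_iff)
  also have "\<dots> = ae_class (\<lambda>x. u x + v x)"
  proof (rule UN_ae_class)
    fix u' assume [measurable]: "u' \<in> borel_measurable lebesgue" and "AE x in lebesgue. u x = u' x"
    then show "ae_class (\<lambda>x. u' x + v x) = ae_class (\<lambda>x. u x + v x)"
      by (intro ae_class_eqI) (auto elim: eventually_mono)
  qed measurable
  finally show ?thesis by (simp add: class_space_def)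
qed

lemma class_scale:
  assumes [measurable]: "u \<in> borel_measurable lebesgue"
  shows "vscale E c (ae_class u) = ae_class (\<lambda>x. c * u x)"
proof -
  have "(\<Union>u'\<in>ae_class u. ae_class (\<lambda>x. c * u' x)) = ae_class (\<lambda>x. c * u x)"
  proof (rule UN_ae_class)
    fix u' assume [measurable]: "u' \<in> borel_measurable lebesgue" and "AE x in lebesgue. u x = u' x"
    then show "ae_class (\<lambda>x. c * u' x) = ae_class (\<lambda>x. c * u x)"
      by (intro ae_class_eqI) (measurable, erule eventually_mono, simp)
  qed measurable
  then show ?thesis by (simp add: class_space_def)
qed

lemma class_norm:
  assumes "u \<in> borel_measurable lebesgue"
  shows "vnorm E (ae_class u) = enn2real (N u)"
proof -
  have mem: "u \<in> ae_class u" using assms by (simp add: mem_ae_rel_iff)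
  have eq: "enn2real (N v) = enn2real (N u)" if "v \<in> ae_class u" for v
    using that assms by (intro arg_cong[where f = enn2real] N_cong[symmetric]) (auto simp: mem_ae_rel_iff)
  have "(\<lambda>u. enn2real (N u)) ` ae_class u = {enn2real (N u)}"
    by (rule trans[OF image_cong[OF refl eq] image_constant[OF mem]])
  then show ?thesis by (simp add: class_space_def)
qed

lemma class_norm_le_iff:
  assumes "u \<in> V" "0 \<le> r"
  shows "vnorm E (ae_class u) \<le> r \<longleftrightarrow> N u \<le> ennreal r"
  using assms by (cases "N u" rule: ennreal_cases) (simp_all add: class_norm V_def)

lemma class_norm_less_iff:
  assumes "u \<in> V" "0 \<le> r"
  shows "vnorm E (ae_class u) < r \<longleftrightarrow> N u < ennreal r"
  using assms by (cases "N u" rule: ennreal_cases) (simp_all add: class_norm V_def ennreal_less_iff)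

lemma modular_le_N:
  assumes "u \<in> borel_measurable lebesgue" "3 * N u < ennreal l" "l \<le> 1"
  shows "\<rho> u \<le> ennreal l"
  using assms by (intro modular_le_gauge le_less_trans[OF gauge_le_N])

text \<open>
  If \<open>N u = 0\<close>, then \<open>AE_convergent\<close> applies to the alternating sequence \<open>u, 0, u, 0, \<dots>\<close>.
\<close>

lemma N_zero_imp_AE:
  assumes u[measurable]: "u \<in> borel_measurable lebesgue" and "N u = 0"
  shows "AE x in lebesgue. u x = 0"
proof -
  define v where "v n = (if even n then u else (\<lambda>_. 0))" for n :: nat
  have "AE x in lebesgue. convergent (\<lambda>n. v n x)"
  proof (rule AE_convergent)
    show "v n \<in> borel_measurable lebesgue" for n by (simp add: v_def)
    have "v (Suc n) x - v n x = (- 1) ^ Suc n * u x" for n x by (simp add: v_def)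
    then have "\<rho> (\<lambda>x. 2 ^ n * (v (Suc n) x - v n x)) = \<rho> (\<lambda>x. 2 ^ n * ((- 1) ^ Suc n * u x))" for n
      by (simp only:)
    also have "\<dots> n \<le> ennreal ((1 / 2) ^ n)" for n
    proof (rule modular_le_N)
      show "3 * N (\<lambda>x. 2 ^ n * ((- 1) ^ Suc n * u x)) < ennreal ((1 / 2) ^ n)"
        using assms(2) N_scale[of u "2 ^ n * (- 1) ^ Suc n"] by (simp add: mult.assoc)
    qed (simp_all add: power_le_one)
    finally show "\<rho> (\<lambda>x. 2 ^ n * (v (Suc n) x - v n x)) \<le> ennreal ((1 / 2) ^ n)" for n .
  qed
  then show ?thesis
  proof eventually_elim
    case (elim x)
    then obtain l where l: "(\<lambda>n. v n x) \<longlonglongrightarrow> l" by (auto simp: convergent_def)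
    have "(\<lambda>n. v (2 * n) x) \<longlonglongrightarrow> l" "(\<lambda>n. v (2 * n + 1) x) \<longlonglongrightarrow> l"
      using LIMSEQ_subseq_LIMSEQ[OF l, of "\<lambda>n. 2 * n"] LIMSEQ_subseq_LIMSEQ[OF l, of "\<lambda>n. 2 * n + 1"]
      by (simp_all add: strict_mono_def comp_def)
    then show ?case by (simp add: v_def LIMSEQ_const_iff)
  qed
qed

lemma real_normed_space: "real_normed_space E"
proof
  note simps = class_zero class_add class_scale class_norm V_measurable ae_class_in_vecs
    V_add V_scale V_zero
  show "vzero E \<in> vecs E" by (simp add: simps)
  fix x assume "x \<in> vecs E"
  then obtain u where u: "u \<in> V" and x: "x = ae_class u" by (rule vecsE)
  note [measurable] = V_measurable[OF u]
  { fix c d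
    show "vscale E c x \<in> vecs E" by (simp add: x simps u)
    show "vadd E x (vzero E) = x" "vadd E x (vscale E (- 1) x) = vzero E"
      "vscale E (c + d) x = vadd E (vscale E c x) (vscale E d x)"
      "vscale E c (vscale E d x) = vscale E (c * d) x"
      "vscale E 1 x = x" by (simp_all add: x simps u algebra_simps)
    show "0 \<le> vnorm E x" by (simp add: x simps u)
    show "vnorm E (vscale E c x) = \<bar>c\<bar> * vnorm E x"
      by (simp add: x simps u N_scale enn2real_mult)
    show "vnorm E x = 0 \<longleftrightarrow> x = vzero E"
    proof
      assume "vnorm E x = 0"
      \<comment> \<open>\<open>enn2real\<close> also sends \<infinity> to 0; membership of u in
        \<open>V\<close> excludes that case.\<close>
      then have "N u = 0 \<or> N u = \<infinity>" by (simp add: x class_norm enn2real_eq_0_iff)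
      then have "N u = 0" using u by (auto simp: V_def)
      then show "x = vzero E"
        unfolding x class_zero by (intro ae_class_eqI N_zero_imp_AE) auto
    next
      assume "x = vzero E"
      then have "N u = N (\<lambda>_. 0)"
        unfolding x class_zero by (intro N_cong ae_class_eqD) auto
      also have "\<dots> = 0" using N_scale[of "\<lambda>_. 0" 0] by simp
      finally show "vnorm E x = 0" by (simp add: x simps u)
    qed }
  fix y assume "y \<in> vecs E"
  then obtain v where v: "v \<in> V" and y: "y = ae_class v" by (rule vecsE)
  { fix c
    show "vadd E x y \<in> vecs E" by (simp add: x y simps u v)
    show "vadd E x y = vadd E y x" "vscale E c (vadd E x y) = vadd E (vscale E c x) (vscale E c y)"
      by (simp_all add: x y simps u v algebra_simps)
    have "N u + N v < \<infinity>" using u v by (simp add: V_def)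
    then have "enn2real (N (\<lambda>x. u x + v x)) \<le> enn2real (N u + N v)"
      using N_add[of u v] u v by (intro enn2real_mono) (auto simp: V_measurable)
    also have "\<dots> = enn2real (N u) + enn2real (N v)"
      using u v by (simp add: V_def enn2real_plus)
    finally show "vnorm E (vadd E x y) \<le> vnorm E x + vnorm E y" by (simp add: x y simps u v) }
  fix z assume "z \<in> vecs E"
  then obtain w where w: "w \<in> V" and z: "z = ae_class w" by (rule vecsE)
  show "vadd E (vadd E x y) z = vadd E x (vadd E y z)"
    by (simp add: x y z simps u v w algebra_simps)
qed

sublocale real_normed_space E
  by (rule real_normed_space)

section \<open>Completeness\<close>

lemma class_vdiff:
  assumes "u \<in> borel_measurable lebesgue" "v \<in> borel_measurable lebesgue"
  shows "vdiff (ae_class u) (ae_class v) = ae_class (\<lambda>x. u x - v x)"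
  using assms by (simp add: vdiff_def class_add class_scale)

lemma V_diff: "\<lbrakk>u \<in> V; v \<in> V\<rbrakk> \<Longrightarrow> (\<lambda>x. u x - v x) \<in> V"
  using V_add[of u "\<lambda>x. (- 1) * v x"] V_scale[of v "- 1"] by simp

lemma class_vdist_less_iff:
  assumes "u \<in> V" "v \<in> V" "0 \<le> r"
  shows "vdist E (ae_class u) (ae_class v) < r \<longleftrightarrow> N (\<lambda>x. u x - v x) < ennreal r"
  using assms
  by (simp add: vdist_eq ae_class_in_vecs class_vdiff V_measurable class_norm_less_iff V_diff)

text \<open>The threshold is dictated by \<open>AE_convergent\<close>: scaling by 2^n turns 4^(-n)
  into the required 2^(-n), and the divisor 3 absorbs the constant in
  \<open>gauge_le_N\<close>.\<close>

lemma AE_limit: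
  assumes v[measurable]: "\<And>n. v n \<in> borel_measurable lebesgue"
    and small: "\<And>n. N (\<lambda>x. v (Suc n) x - v n x) < ennreal ((1 / 4) ^ n / 3)"
  obtains u where "u \<in> borel_measurable lebesgue" "AE x in lebesgue. (\<lambda>n. v n x) \<longlonglongrightarrow> u x"
proof -
  have "\<rho> (\<lambda>x. 2 ^ n * (v (Suc n) x - v n x)) \<le> ennreal ((1 / 2) ^ n)" for n
  proof (rule modular_le_N)
    have "3 * N (\<lambda>x. 2 ^ n * (v (Suc n) x - v n x)) = ennreal (3 * 2 ^ n) * N (\<lambda>x. v (Suc n) x - v n x)"
      using ennreal_mult'[of 3 "2 ^ n"] N_scale[of "\<lambda>x. v (Suc n) x - v n x" "2 ^ n"]
      by (simp add: mult.assoc)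
    also have "\<dots> < ennreal (3 * 2 ^ n) * ennreal ((1 / 4) ^ n / 3)"
      using small by (intro ennreal_mult_strict_left_mono) auto
    also have "\<dots> = ennreal (2 ^ n * (1 / 4) ^ n)" by (simp add: ennreal_mult'[symmetric])
    also have "(2 :: real) ^ n * (1 / 4) ^ n = (1 / 2) ^ n" by (simp add: power_mult_distrib[symmetric])
    finally show "3 * N (\<lambda>x. 2 ^ n * (v (Suc n) x - v n x)) < ennreal ((1 / 2) ^ n)" .
  qed (simp_all add: power_le_one)
  then have "AE x in lebesgue. convergent (\<lambda>n. v n x)" by (rule AE_convergent[OF v])
  then have "AE x in lebesgue. (\<lambda>n. v n x) \<longlonglongrightarrow> lim (\<lambda>n. v n x)"
    by (simp add: convergent_LIMSEQ_iff)
  moreover have "(\<lambda>x. lim (\<lambda>n. v n x)) \<in> borel_measurable lebesgue" by measurable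
  ultimately show thesis using that by blast
qed

text \<open>The limit u is built from a subsequence only, but Fatou's lemma compares it with every
  representative \<open>w m\<close> beyond \<open>K j\<close>. Convergence of the whole sequence
  therefore follows at once.\<close>

lemma mcomplete: "metric.mcomplete"
  unfolding metric.mcomplete_def
proof (intro allI impI)
  fix \<sigma> assume \<sigma>: "metric.MCauchy \<sigma>"
  then have "\<forall>n. \<exists>u. u \<in> V \<and> \<sigma> n = ae_class u"
    by (metis metric.MCauchy_def range_subsetD vecsE)
  then obtain w where w: "\<And>n. w n \<in> V" "\<And>n. \<sigma> n = ae_class (w n)" by metis
  have "\<forall>j. \<exists>K. \<forall>m n. K \<le> m \<longrightarrow> K \<le> n \<longrightarrow> vdist E (\<sigma> m) (\<sigma> n) < (1 / 4) ^ j / 3"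
  proof
    fix j
    have "0 < (1 / 4 :: real) ^ j / 3" by simp
    then show "\<exists>K. \<forall>m n. K \<le> m \<longrightarrow> K \<le> n \<longrightarrow> vdist E (\<sigma> m) (\<sigma> n) < (1 / 4) ^ j / 3"
      using \<sigma> unfolding metric.MCauchy_def by blast
  qed
  then obtain K where K: "\<And>j m n. \<lbrakk>K j \<le> m; K j \<le> n\<rbrakk> \<Longrightarrow> vdist E (\<sigma> m) (\<sigma> n) < (1 / 4) ^ j / 3"
    by metis
  have NK: "N (\<lambda>x. w m x - w n x) < ennreal ((1 / 4) ^ j / 3)" if "K j \<le> m" "K j \<le> n" for j m n
    using K[OF that] class_vdist_less_iff[OF w(1) w(1), of "(1 / 4) ^ j / 3"] unfolding w(2) by simp
  \<comment> \<open>Summing the thresholds makes \<open>k n\<close> dominate \<open>K 0\<close>,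
    ..., \<open>K n\<close> simultaneously.\<close>
  define k where "k n = (\<Sum>i\<le>n. K i)" for n
  have k: "K j \<le> k n" if "j \<le> n" for j n
    unfolding k_def using that by (intro member_le_sum) auto
  define v where "v n = w (k n)" for n
  note meas [measurable] = V_measurable[OF w(1)]
  have [measurable]: "v n \<in> borel_measurable lebesgue" for n by (simp add: v_def)
  obtain u where [measurable]: "u \<in> borel_measurable lebesgue"
    and lim: "AE x in lebesgue. (\<lambda>n. v n x) \<longlonglongrightarrow> u x"
  proof (rule AE_limit[of v])
    show "N (\<lambda>x. v (Suc n) x - v n x) < ennreal ((1 / 4) ^ n / 3)" for n
      unfolding v_def by (intro NK k) auto
  qed auto
  have gauge_u: "gauge (\<lambda>x. u x - w m x) \<le> ennreal ((1 / 4) ^ j)" if m: "K j \<le> m" for j m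
  proof (rule gauge_le)
    let ?l = "(1 / 4 :: real) ^ j"
    \<comment> \<open>The shift by j puts every index \<open>k (n + j)\<close> beyond
      \<open>K j\<close>. All gauges of \<open>v (n + j) - w m\<close> are then below
      \<open>?l\<close>, so each modular in the lower limit is at most 1.\<close>
    have "\<rho> (\<lambda>x. (u x - w m x) / ?l) \<le> liminf (\<lambda>n. \<rho> (\<lambda>x. (v (n + j) x - w m x) / ?l))"
    proof (rule Fatou)
      show "AE x in lebesgue. (\<lambda>n. (v (n + j) x - w m x) / ?l) \<longlonglongrightarrow> (u x - w m x) / ?l"
        using lim
      proof eventually_elim
        case (elim x)
        then have "(\<lambda>n. v (n + j) x) \<longlonglongrightarrow> u x" by (rule LIMSEQ_ignore_initial_segment)
        then show ?case by (intro tendsto_intros) auto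
      qed
    qed measurable
    also have "\<dots> \<le> liminf (\<lambda>n. 1)"
    proof (intro Liminf_mono always_eventually allI modular_le_of_gauge_less)
      fix n
      have "3 * N (\<lambda>x. v (n + j) x - w m x) < 3 * ennreal (?l / 3)"
        unfolding v_def by (intro ennreal_mult_strict_left_mono NK k m) auto
      also have "\<dots> = ennreal ?l"
        using ennreal_mult'[of 3 "?l / 3"] by simp
      finally show "gauge (\<lambda>x. v (n + j) x - w m x) < ennreal ?l"
        by (rule le_less_trans[OF gauge_le_N, rotated]) measurable
    qed measurable
    finally show "\<rho> (\<lambda>x. (u x - w m x) / ?l) \<le> 1" by (simp add: Liminf_const)
  qed simp
  have Nu: "N (\<lambda>x. u x - w m x) \<le> ennreal (3 * (1 / 4) ^ j)" if "K j \<le> m" for j m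
  proof -
    have "N (\<lambda>x. u x - w m x) \<le> 3 * gauge (\<lambda>x. u x - w m x)" by (rule N_le_gauge) measurable
    also have "\<dots> \<le> 3 * ennreal ((1 / 4) ^ j)" by (intro mult_left_mono gauge_u that) simp
    finally show ?thesis using ennreal_mult'[of 3 "(1 / 4) ^ j"] by simp
  qed
  have "(\<lambda>x. u x - w (K 0) x) \<in> V"
    using Nu[of 0 "K 0"] by (auto simp: V_def intro: le_less_trans)
  from V_add[OF this w(1)[of "K 0"]] have u: "u \<in> V" by simp
  have "limitin metric.mtopology \<sigma> (ae_class u) sequentially"
    unfolding metric.limitin_metric
  proof (intro conjI allI impI)
    show "ae_class u \<in> vecs E" by (rule ae_class_in_vecs[OF u])
    fix \<epsilon> :: real assume "0 < \<epsilon>"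
    then obtain j where j: "(1 / 4) ^ j < \<epsilon> / 3"
      using real_arch_pow_inv[of "\<epsilon> / 3" "1 / 4"] by auto
    show "\<forall>\<^sub>F n in sequentially. \<sigma> n \<in> vecs E \<and> vdist E (\<sigma> n) (ae_class u) < \<epsilon>"
      using eventually_ge_at_top[of "K j"]
    proof eventually_elim
      case (elim m)
      have "N (\<lambda>x. u x - w m x) < ennreal \<epsilon>"
        using Nu[OF elim] j \<open>0 < \<epsilon>\<close> by (elim le_less_trans) (simp add: ennreal_less_iff)
      then have "vdist E (ae_class u) (\<sigma> m) < \<epsilon>"
        using \<open>0 < \<epsilon>\<close> by (simp add: w class_vdist_less_iff u)
      then show ?case by (simp add: metric.commute w ae_class_in_vecs)
    qed
  qed
  then show "\<exists>x. limitin metric.mtopology \<sigma> x sequentially" by blast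
qed

theorem banach_space: "banach_space E"
  unfolding banach_space_def using real_normed_space mcomplete by blast

section \<open>Uniform convexity of the modular ball, and reflexivity\<close>

lemma modular_ge:
  assumes "0 < \<epsilon>"
  obtains \<eta> where "0 < \<eta>" "\<eta> < 1"
    "\<And>u. \<lbrakk>u \<in> borel_measurable lebesgue; ennreal \<epsilon> \<le> N u\<rbrakk> \<Longrightarrow> ennreal \<eta> \<le> \<rho> (\<lambda>x. 1 / 2 * u x)"
proof -
  \<comment> \<open>If the modular of u / 2 were at most l^p, its gauge would be at most l, hence N
    u \<le> 3 gauge u = 6 gauge (u / 2) \<le> 6 l. Any divisor above 6 makes this less than
    \<epsilon>. The later halving of l^p keeps \<eta> strictly below 1.\<close>
  define l where "l = min 1 (\<epsilon> / 7)"
  have l: "0 < l" "l \<le> 1" "l \<le> \<epsilon> / 7" using assms by (auto simp: l_def)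
  have lp: "0 < l powr p" "l powr p \<le> 1"
    using l p_pos by (auto intro: powr_le1)
  show thesis
  proof (rule that[of "l powr p / 2"])
    fix u assume u[measurable]: "u \<in> borel_measurable lebesgue" and N: "ennreal \<epsilon> \<le> N u"
    show "ennreal (l powr p / 2) \<le> \<rho> (\<lambda>x. 1 / 2 * u x)"
    proof (rule ccontr)
      assume "\<not> ?thesis"
      then have "\<rho> (\<lambda>x. 1 / 2 * u x) \<le> ennreal (l powr p / 2)" by simp
      also have "\<dots> \<le> ennreal (l powr p)" using lp by (intro ennreal_leI) simp
      finally have "gauge (\<lambda>x. 1 / 2 * u x) \<le> ennreal l"
        using l by (intro gauge_le_of_modular) auto
      then have "6 * gauge (\<lambda>x. 1 / 2 * u x) \<le> 6 * ennreal l" by (rule mult_left_mono) simp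
      moreover have "6 * gauge (\<lambda>x. 1 / 2 * u x) = 3 * gauge u"
      proof -
        have "6 * ennreal (1 / 2) = 3" using ennreal_mult'[of 6 "1 / 2"] by simp
        then show ?thesis unfolding gauge_scale by (simp add: mult.assoc[symmetric])
      qed
      ultimately have "N u \<le> ennreal (6 * l)"
        using N_le_gauge[OF u] ennreal_mult'[of 6 l] by simp
      with N have "ennreal \<epsilon> \<le> ennreal (6 * l)" by (rule order_trans)
      then have "\<epsilon> \<le> 6 * l" using l by (subst (asm) ennreal_le_iff) auto
      then show False using l assms by linarith
    qed
  qed (use lp in auto)
qed

text \<open>Lamperti's inequality bounds the modular of the midpoint by 1 minus that of the half
  difference, hence by 1 - \<eta>. Division by q multiplies the modular by at most q^(-p), so q = (1
  - \<eta>)^(1/p) is the factor that brings the bound back to exactly 1.\<close>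

lemma midpoint_shrinks:
  assumes "0 < \<epsilon>"
  obtains q where "0 < q" "q < 1"
    "\<And>u v. \<lbrakk>u \<in> borel_measurable lebesgue; v \<in> borel_measurable lebesgue; \<rho> u \<le> 1; \<rho> v \<le> 1;
      ennreal \<epsilon> \<le> N (\<lambda>x. u x - v x)\<rbrakk> \<Longrightarrow> \<rho> (\<lambda>x. 1 / q * (1 / 2 * u x + 1 / 2 * v x)) \<le> 1"
proof -
  obtain \<eta> where \<eta>: "0 < \<eta>" "\<eta> < 1"
    "\<And>u. \<lbrakk>u \<in> borel_measurable lebesgue; ennreal \<epsilon> \<le> N u\<rbrakk> \<Longrightarrow> ennreal \<eta> \<le> \<rho> (\<lambda>x. 1 / 2 * u x)"
    using modular_ge[OF assms] by blast
  define q where "q = (1 - \<eta>) powr (1 / p)"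
  have q: "0 < q" "q < 1"
    using \<eta> p_pos powr_less_mono2[of "1 / p" "1 - \<eta>" 1] by (auto simp: q_def)
  have qp: "(1 / q) powr p * (1 - \<eta>) = 1"
    using \<eta> p_pos by (simp add: q_def powr_divide powr_powr)
  show thesis
  proof (rule that[OF q])
    fix u v assume m[measurable]: "u \<in> borel_measurable lebesgue" "v \<in> borel_measurable lebesgue"
      and uv: "\<rho> u \<le> 1" "\<rho> v \<le> 1" and N: "ennreal \<epsilon> \<le> N (\<lambda>x. u x - v x)"
    let ?s = "\<rho> (\<lambda>x. 1 / 2 * u x + 1 / 2 * v x)" and ?d = "\<rho> (\<lambda>x. 1 / 2 * u x - 1 / 2 * v x)"
    have "ennreal \<eta> \<le> ?d"
      using \<eta>(3)[OF _ N] by (simp add: right_diff_distrib)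
    then have "?s + ennreal \<eta> \<le> ?s + ?d" by (rule add_left_mono)
    also have "\<dots> \<le> ennreal (1 / 2) * (\<rho> u + \<rho> v)" by (rule parallelogram) measurable
    also have "\<dots> \<le> ennreal (1 / 2) * (1 + 1)" using uv by (intro mult_left_mono add_mono) auto
    also have "\<dots> = 1" using ennreal_mult'[of "1 / 2" 2] by simp
    finally have "?s \<le> 1 - ennreal \<eta>" by (simp add: ennreal_le_minus_iff)
    also have "\<dots> = ennreal (1 - \<eta>)" using \<eta> ennreal_minus[of \<eta> 1] by simp
    finally have s: "?s \<le> ennreal (1 - \<eta>)" .
    have "\<rho> (\<lambda>x. 1 / q * (1 / 2 * u x + 1 / 2 * v x)) \<le> ennreal ((1 / q) powr p) * ?s"
      using q by (intro growth) auto
    also have "\<dots> \<le> ennreal ((1 / q) powr p) * ennreal (1 - \<eta>)"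
      using s by (rule mult_left_mono) simp
    also have "\<dots> = 1" using \<eta> qp by (simp add: ennreal_mult'[symmetric])
    finally show "\<rho> (\<lambda>x. 1 / q * (1 / 2 * u x + 1 / 2 * v x)) \<le> 1" .
  qed
qed

lemma modular_ball_in_V:
  assumes "u \<in> borel_measurable lebesgue" "\<rho> u \<le> 1"
  shows "N u \<le> ennreal 3" "u \<in> V"
proof -
  have "gauge u \<le> ennreal 1" using assms by (intro gauge_le) auto
  then have "3 * gauge u \<le> 3 * 1" by (intro mult_left_mono) auto
  then show "N u \<le> ennreal 3" using N_le_gauge[OF assms(1)] by simp
  then show "u \<in> V" using assms(1) by (auto simp: V_def intro: le_less_trans)
qed

theorem reflexive_space: "reflexive_space E"
proof -
  define B where "B = ae_class ` {u \<in> borel_measurable lebesgue. \<rho> u \<le> 1}"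
  \<comment> \<open>Radius 1/4 gives 3 N u \<le> 3/4 < 1, the strict inequality that
    \<open>modular_le_N\<close> asks for. The outer radius 3 is the constant in
    \<open>N_le_gauge\<close>, since the gauge is at most 1 on the modular ball.\<close>
  interpret uniformly_convex_body E B "1 / 4" 3
  proof
    show "B \<subseteq> vecs E" by (auto simp: B_def intro!: ae_class_in_vecs modular_ball_in_V)
    show "0 < (1 / 4 :: real)" by simp
    show "metric.mcomplete" by (rule mcomplete)
    show "x \<in> B" if x: "x \<in> vecs E" and xn: "vnorm E x \<le> 1 / 4" for x
    proof -
      obtain u where u: "u \<in> V" "x = ae_class u" using x by (rule vecsE)
      have "N u \<le> ennreal (1 / 4)" using xn class_norm_le_iff[OF u(1), of "1 / 4"] unfolding u(2) by simp
      then have "3 * N u \<le> 3 * ennreal (1 / 4)" by (rule mult_left_mono) simp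
      also have "\<dots> = ennreal (3 / 4)" using ennreal_mult'[of 3 "1 / 4"] by simp
      also have "\<dots> < ennreal 1" by (simp add: ennreal_less_iff del: ennreal_1)
      finally have "\<rho> u \<le> ennreal 1" using u by (intro modular_le_N) (auto simp: V_measurable)
      then show ?thesis using u by (auto simp: B_def V_measurable)
    qed
    show "vnorm E x \<le> 3" if "x \<in> B" for x
      using that modular_ball_in_V by (auto simp: B_def class_norm_le_iff)
    fix \<epsilon> :: real assume "0 < \<epsilon>"
    then obtain q where q: "0 < q" "q < 1"
      and shrink: "\<And>u v. \<lbrakk>u \<in> borel_measurable lebesgue; v \<in> borel_measurable lebesgue; \<rho> u \<le> 1; \<rho> v \<le> 1;
      ennreal \<epsilon> \<le> N (\<lambda>x. u x - v x)\<rbrakk> \<Longrightarrow> \<rho> (\<lambda>x. 1 / q * (1 / 2 * u x + 1 / 2 * v x)) \<le> 1"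
      using midpoint_shrinks by blast
    have "\<exists>z\<in>B. vadd E x y = vscale E (2 * (1 - (1 - q))) z"
      if xyB: "x \<in> B" "y \<in> B" and xy: "\<epsilon> \<le> vnorm E (vdiff x y)" for x y
    proof -
      obtain u v where u[measurable]: "u \<in> borel_measurable lebesgue" "\<rho> u \<le> 1" "x = ae_class u"
        and v[measurable]: "v \<in> borel_measurable lebesgue" "\<rho> v \<le> 1" "y = ae_class v"
        using xyB unfolding B_def by blast
      have "(\<lambda>x. u x - v x) \<in> V" using u v by (intro V_diff modular_ball_in_V)
      then have "ennreal \<epsilon> \<le> N (\<lambda>x. u x - v x)"
        using xy class_norm_less_iff[of "\<lambda>x. u x - v x" \<epsilon>] \<open>0 < \<epsilon>\<close> u v
        by (auto simp: class_vdiff not_less[symmetric])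
      then have "\<rho> (\<lambda>x. 1 / q * (1 / 2 * u x + 1 / 2 * v x)) \<le> 1" by (intro shrink u v)
      then have "ae_class (\<lambda>x. 1 / q * (1 / 2 * u x + 1 / 2 * v x)) \<in> B"
        by (auto simp: B_def)
      moreover have "vadd E x y = vscale E (2 * (1 - (1 - q))) (ae_class (\<lambda>x. 1 / q * (1 / 2 * u x + 1 / 2 * v x)))"
        using q by (simp add: u(3) v(3) class_add class_scale u(1) v(1) distrib_left)
      ultimately show ?thesis by blast
    qed
    then show "\<exists>\<delta>>0. \<delta> < 1 \<and> (\<forall>x\<in>B. \<forall>y\<in>B. \<epsilon> \<le> vnorm E (vdiff x y) \<longrightarrow>
          (\<exists>z\<in>B. vadd E x y = vscale E (2 * (1 - \<delta>)) z))"
      using q by (intro exI[of _ "1 - q"]) auto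
  qed
  show ?thesis by (rule reflexive)
qed

end

text \<open>Each modular is at most the sum, so each gauge is at most the gauge of the sum; this
  gives one factor 3. Conversely, for l above N u the three modulars of u / l are at most 1, their
  sum is at most 3, and convexity brings it to at most 1 for u / (3 l).\<close>

lemma complete_modular_norm_sum3:
  fixes \<rho> \<sigma> \<tau> :: "(real^'n \<Rightarrow> real) \<Rightarrow> ennreal"
  assumes \<rho>: "modular lebesgue \<rho> p" and \<sigma>: "modular lebesgue \<sigma> p" and \<tau>: "modular lebesgue \<tau> p"
    and N: "\<And>u. u \<in> borel_measurable lebesgue
      \<Longrightarrow> N u = modular.gauge \<rho> u + modular.gauge \<sigma> u + modular.gauge \<tau> u"
    and conv: "\<And>w. \<lbrakk>\<And>n. w n \<in> borel_measurable lebesgue;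
      \<And>n. \<rho> (\<lambda>x. 2 ^ n * (w (Suc n) x - w n x)) \<le> ennreal ((1 / 2) ^ n);
      \<And>n. \<sigma> (\<lambda>x. 2 ^ n * (w (Suc n) x - w n x)) \<le> ennreal ((1 / 2) ^ n);
      \<And>n. \<tau> (\<lambda>x. 2 ^ n * (w (Suc n) x - w n x)) \<le> ennreal ((1 / 2) ^ n)\<rbrakk>
      \<Longrightarrow> AE x in lebesgue. convergent (\<lambda>n. w n x)"
  shows "complete_modular_norm (\<lambda>u. \<rho> u + \<sigma> u + \<tau> u) p N"
proof -
  interpret \<rho>: modular lebesgue \<rho> p by fact
  interpret \<sigma>: modular lebesgue \<sigma> p by fact
  interpret \<tau>: modular lebesgue \<tau> p by fact
  let ?\<rho> = "\<lambda>u. \<rho> u + \<sigma> u + \<tau> u"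
  interpret S: modular lebesgue ?\<rho> p by (intro modular_add assms)
  have le: "\<rho> u \<le> ?\<rho> u" "\<sigma> u \<le> ?\<rho> u" "\<tau> u \<le> ?\<rho> u" for u
    by (simp_all add: add.assoc add_increasing add_increasing2)
  show ?thesis
  proof
    fix u :: "real^'n \<Rightarrow> real" assume u[measurable]: "u \<in> borel_measurable lebesgue"
    show "N (\<lambda>x. c * u x) = ennreal \<bar>c\<bar> * N u" for c
      by (simp add: N \<rho>.gauge_scale \<sigma>.gauge_scale \<tau>.gauge_scale distrib_left)
    { fix v :: "real^'n \<Rightarrow> real" assume [measurable]: "v \<in> borel_measurable lebesgue"
      show "N u = N v" if "AE x in lebesgue. u x = v x"
        using that \<rho>.gauge_cong_AE[of u v] \<sigma>.gauge_cong_AE[of u v] \<tau>.gauge_cong_AE[of u v]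
        by (simp add: N)
      have "N (\<lambda>x. u x + v x) \<le> (\<rho>.gauge u + \<rho>.gauge v) + (\<sigma>.gauge u + \<sigma>.gauge v) + (\<tau>.gauge u + \<tau>.gauge v)"
        by (simp add: N add_mono \<rho>.gauge_add \<sigma>.gauge_add \<tau>.gauge_add)
      then show "N (\<lambda>x. u x + v x) \<le> N u + N v" by (simp add: N ac_simps) }
    have "\<rho>.gauge u \<le> S.gauge u" "\<sigma>.gauge u \<le> S.gauge u" "\<tau>.gauge u \<le> S.gauge u"
      by (auto intro!: S.gauge_greatest \<rho>.gauge_le \<sigma>.gauge_le \<tau>.gauge_le
          intro: order_trans[OF le(1)] order_trans[OF le(2)] order_trans[OF le(3)])
    then have "N u \<le> S.gauge u + S.gauge u + S.gauge u"
      by (simp add: N add_mono)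
    also have "\<dots> = (1 + 1 + 1) * S.gauge u" by (simp only: distrib_right mult_1)
    finally show "N u \<le> 3 * S.gauge u" by simp
    show "S.gauge u \<le> 3 * N u"
    proof (rule ennreal_le_epsilon)
      fix e :: real assume e: "0 < e" and "3 * N u < top"
      then have "N u < top" by (auto simp: ennreal_mult_less_top)
      then obtain r where r: "N u = ennreal r" "0 \<le> r" by (cases "N u" rule: ennreal_cases) auto
      \<comment> \<open>Exceeding N u by e / 3 makes the admissible value 3 l overshoot 3 N u by
        exactly e.\<close>
      define l where "l = r + e / 3"
      have l: "0 < l" using r e by (simp add: l_def)
      have "N u < ennreal l" using r e by (simp add: l_def ennreal_less_iff)
      then have "\<rho>.gauge u < ennreal l" "\<sigma>.gauge u < ennreal l" "\<tau>.gauge u < ennreal l"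
        by (auto simp: N[OF u] intro: le_less_trans[rotated] add_increasing add_increasing2)
      then have le1: "\<rho> (\<lambda>x. u x / l) \<le> 1" "\<sigma> (\<lambda>x. u x / l) \<le> 1" "\<tau> (\<lambda>x. u x / l) \<le> 1"
        by (auto intro: \<rho>.modular_le_of_gauge_less \<sigma>.modular_le_of_gauge_less \<tau>.modular_le_of_gauge_less)
      have "?\<rho> (\<lambda>x. 1 / 3 * (u x / l)) \<le> ennreal (1 / 3) * ?\<rho> (\<lambda>x. u x / l)"
        by (rule S.scale_le) auto
      also have "\<dots> \<le> ennreal (1 / 3) * (1 + 1 + 1)"
        by (intro mult_left_mono add_mono le1) simp
      also have "\<dots> = 1" using ennreal_mult'[of "1 / 3" 3] by simp
      finally have "S.gauge u \<le> ennreal (3 * l)"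
        using l by (intro S.gauge_le) (simp_all add: mult.commute)
      also have "3 * l = 3 * r + e" by (simp add: l_def)
      also have "ennreal (3 * r + e) = 3 * N u + ennreal e"
        using r e ennreal_mult'[of 3 r] by simp
      finally show "S.gauge u \<le> 3 * N u + ennreal e" .
    qed
  next
    fix w :: "nat \<Rightarrow> real^'n \<Rightarrow> real"
    assume w: "\<And>n. w n \<in> borel_measurable lebesgue"
      and small: "\<And>n. ?\<rho> (\<lambda>x. 2 ^ n * (w (Suc n) x - w n x)) \<le> ennreal ((1 / 2) ^ n)"
    show "AE x in lebesgue. convergent (\<lambda>n. w n x)"
      by (rule conv[OF w]) (rule order_trans[OF le(1) small] order_trans[OF le(2) small]
          order_trans[OF le(3) small])+
  qed
qed

section \<open>Lebesgue measure on a product\<close>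

lemma sets_lebesgue_of_borel: "S \<in> sets borel \<Longrightarrow> S \<in> sets lebesgue"
  by (simp add: sets_completionI_sets)

text \<open>Lebesgue measure on a product is the completion of the product of the Borel measures,
  not the product of the completions. Statements about null sets are therefore moved to
  \<open>lborel\<close>, where \<open>lborel_prod\<close> applies, and a cylinder over a null set is
  null.\<close>

lemma AE_lebesgue_prod:
  fixes P :: "'a::euclidean_space \<Rightarrow> bool"
  assumes "AE x in lebesgue. P x"
  shows "AE z in lebesgue. P (fst (z :: 'a \<times> 'b::euclidean_space))"
    and "AE z in lebesgue. P (snd (z :: 'b::euclidean_space \<times> 'a))"
proof -
  have "AE x in lborel. P x" using assms by (simp add: AE_completion_iff)
  then obtain N where N: "N \<in> null_sets lborel" "{x. \<not> P x} \<subseteq> N"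
    by (auto simp: eventually_ae_filter)
  have "N \<times> (UNIV :: 'b set) \<in> null_sets (lborel \<Otimes>\<^sub>M lborel)"
    "(UNIV :: 'b set) \<times> N \<in> null_sets (lborel \<Otimes>\<^sub>M lborel)"
    using N(1) by (auto intro: lborel.times_in_null_sets1 lborel.times_in_null_sets2)
  then have "N \<times> (UNIV :: 'b set) \<in> null_sets lborel" "(UNIV :: 'b set) \<times> N \<in> null_sets lborel"
    by (simp_all only: lborel_prod)
  then have "AE z in lborel. P (fst (z :: 'a \<times> 'b))" "AE z in lborel. P (snd (z :: 'b \<times> 'a))"
    using N(2) by (auto intro!: AE_I')
  then show "AE z in lebesgue. P (fst (z :: 'a \<times> 'b))" "AE z in lebesgue. P (snd (z :: 'b \<times> 'a))"
    by (simp_all add: AE_completion_iff)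
qed

lemma AE_lebesgue_pair:
  fixes Q :: "'a::euclidean_space \<times> 'b::euclidean_space \<Rightarrow> bool"
  assumes "AE z in lebesgue. Q z"
  shows "AE x in lebesgue. AE y in lebesgue. Q (x, y)"
proof -
  have "AE z in lborel \<Otimes>\<^sub>M lborel. Q z"
    using assms unfolding lborel_prod by (simp add: AE_completion_iff)
  then have "AE x in lborel. AE y in lborel. Q (x, y)" by (rule lborel_pair.AE_pair)
  then show ?thesis by (simp add: AE_completion_iff)
qed

text \<open>Preimages under f and g differ within a null set, and the Lebesgue sigma-algebra is
  complete.\<close>

lemma measurable_lebesgue_AE:
  fixes f g :: "'a::euclidean_space \<Rightarrow> real"
  assumes g: "g \<in> borel_measurable lebesgue" and ae: "AE x in lebesgue. f x = g x"
  shows "f \<in> borel_measurable lebesgue"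
proof (rule measurableI)
  fix A :: "real set" assume "A \<in> sets borel"
  then have A: "g -` A \<inter> space lebesgue \<in> sets lebesgue" by (rule measurable_sets[OF g])
  have "AE x in lebesgue. x \<in> g -` A \<inter> space lebesgue \<longleftrightarrow> x \<in> f -` A \<inter> space lebesgue"
    using ae by eventually_elim simp
  from completion.in_sets_AE[OF this A]
  show "f -` A \<inter> space lebesgue \<in> sets lebesgue" by simp
qed simp

text \<open>Composing a merely Lebesgue measurable function with a projection needs care. A Borel
  representative can be composed freely, and the two compositions differ only on a null
  cylinder.\<close>

lemma measurable_lebesgue_fst_snd:
  fixes u :: "'a::euclidean_space \<Rightarrow> real"
  assumes "u \<in> borel_measurable lebesgue"
  shows "(\<lambda>z :: 'a \<times> 'b::euclidean_space. u (fst z)) \<in> borel_measurable lebesgue"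
    and "(\<lambda>z :: 'b::euclidean_space \<times> 'a. u (snd z)) \<in> borel_measurable lebesgue"
proof -
  obtain g where g: "g \<in> borel_measurable lborel" and ae: "AE x in lborel. u x = g x"
    using completion_ex_borel_measurable_real[OF assms] by blast
  have [measurable]: "g \<in> borel_measurable borel" using g by simp
  have ae: "AE x in lebesgue. u x = g x" using ae by (simp add: AE_completion_iff)
  have "(\<lambda>z :: 'a \<times> 'b. fst z) \<in> borel_measurable borel"
    "(\<lambda>z :: 'b \<times> 'a. snd z) \<in> borel_measurable borel"
    by (intro borel_measurable_continuous_onI continuous_intros)+
  then have "(\<lambda>z :: 'a \<times> 'b. g (fst z)) \<in> borel_measurable borel"
    "(\<lambda>z :: 'b \<times> 'a. g (snd z)) \<in> borel_measurable borel"
    by measurable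
  then have "(\<lambda>z :: 'a \<times> 'b. g (fst z)) \<in> borel_measurable lebesgue"
    "(\<lambda>z :: 'b \<times> 'a. g (snd z)) \<in> borel_measurable lebesgue"
    by (auto intro: measurable_completion)
  then show "(\<lambda>z :: 'a \<times> 'b. u (fst z)) \<in> borel_measurable lebesgue"
    "(\<lambda>z :: 'b \<times> 'a. u (snd z)) \<in> borel_measurable lebesgue"
    using AE_lebesgue_prod[OF ae] by (auto intro: measurable_lebesgue_AE)
qed

section \<open>The fractional Musielak--Sobolev space\<close>

text \<open>The exponent bound says that ln \<Phi> - p ln has nonpositive derivative on the positive
  half-line. Comparing its values at t and r t and exponentiating gives the power growth.\<close>

lemma Phi_of_growth:
  assumes cont: "continuous_on UNIV (phi_of a x y)"
    and pos: "\<And>t. 0 < t \<Longrightarrow> 0 < Phi_of a x y t"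
    and bound: "\<And>t. 0 < t \<Longrightarrow> t * phi_of a x y t / Phi_of a x y t \<le> p"
    and r: "1 \<le> r" and t: "0 \<le> t"
  shows "Phi_of a x y (r * t) \<le> r powr p * Phi_of a x y t"
proof (cases "t = 0")
  case True
  have "Phi_of a x y 0 = 0" by (simp add: Phi_of_def)
  then show ?thesis using True by simp
next
  case False
  then have t: "0 < t" using t by simp
  define h where "h \<tau> = ln (Phi_of a x y \<tau>) - p * ln \<tau>" for \<tau>
  have "h (r * t) \<le> h t"
  proof (rule DERIV_nonpos_imp_nonincreasing[of t "r * t" h])
    show "t \<le> r * t" using r t by simp
    fix \<tau> assume "t \<le> \<tau>"
    then have \<tau>: "0 < \<tau>" using t by simp
    \<comment> \<open>The right end \<open>\<tau> + 1\<close> places \<tau> in the interior, so the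
      derivative within the interval is a full derivative.\<close>
    have "((\<lambda>x'. integral {0..x'} (phi_of a x y)) has_real_derivative phi_of a x y \<tau>) (at \<tau> within {0..\<tau> + 1})"
      using \<tau> by (intro integral_has_real_derivative continuous_on_subset[OF cont]) auto
    then have "((\<lambda>x'. integral {0..x'} (phi_of a x y)) has_real_derivative phi_of a x y \<tau>) (at \<tau>)"
      using \<tau> by (subst (asm) at_within_interior) auto
    then have D: "(Phi_of a x y has_real_derivative phi_of a x y \<tau>) (at \<tau>)"
      by (simp add: Phi_of_def[abs_def])
    have "(h has_real_derivative (phi_of a x y \<tau> / Phi_of a x y \<tau> - p * (1 / \<tau>))) (at \<tau>)"
      unfolding h_def using pos[OF \<tau>] \<tau>
      by (auto intro!: derivative_eq_intros D)
    moreover have "phi_of a x y \<tau> / Phi_of a x y \<tau> - p * (1 / \<tau>) \<le> 0"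
      using bound[OF \<tau>] \<tau> by (simp add: field_simps)
    ultimately show "\<exists>y. (h has_real_derivative y) (at \<tau>) \<and> y \<le> 0" by blast
  qed
  then have "ln (Phi_of a x y (r * t)) \<le> ln (Phi_of a x y t) + p * ln r"
    using r t by (simp add: h_def ln_mult algebra_simps)
  then have "exp (ln (Phi_of a x y (r * t))) \<le> exp (ln (Phi_of a x y t) + p * ln r)"
    by simp
  then show ?thesis
    using r t pos[of t] pos[of "r * t"] by (simp add: exp_add powr_def mult.commute)
qed

text \<open>Only the measurability condition refers to the measure, and passing to a density keeps
  the sigma-algebra; one lemma thus serves all the weights.\<close>

lemma musielak_density:
  assumes \<Psi>: "musielak_function \<Psi>" and p: "0 < p"
    and growth: "\<And>x r t. \<lbrakk>1 \<le> r; 0 \<le> t\<rbrakk> \<Longrightarrow> \<Psi> x (r * t) \<le> r powr p * \<Psi> x t"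
    and convex_sqrt: "\<And>x. convex_on {0..} (\<lambda>t. \<Psi> x (sqrt t))"
  shows "musielak (density lebesgue W) \<Psi> p"
proof
  have N: "N_function (\<Psi> x)" for x using \<Psi> by (simp add: musielak_function_def)
  show "0 < p" by (rule p)
  show "(\<lambda>z. \<Psi> z t) \<in> borel_measurable (density lebesgue W)" if "0 \<le> t" for t
    using that \<Psi> by (simp add: musielak_function_def)
  show "continuous_on {0..} (\<Psi> z)" "convex_on {0..} (\<Psi> z)" "\<Psi> z 0 = 0" for z
    using N[of z] by (simp_all add: N_function_def)
  show "\<Psi> z r \<le> \<Psi> z t" if "0 \<le> r" "r \<le> t" for z r t
    using N[of z] that strict_mono_on_leD[of "{0..}" "\<Psi> z" r t] by (simp add: N_function_def)
  show "0 < \<Psi> z t" if "0 < t" for z t using N[of z] that by (simp add: N_function_def)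
qed (fact growth convex_sqrt)+

locale fractional_musielak =
  fixes \<Omega> :: "(real^'n) set" and \<beta> :: "real^'n \<Rightarrow> real" and s :: "real^'n \<Rightarrow> real^'n \<Rightarrow> real"
    and a :: "real^'n \<Rightarrow> real^'n \<Rightarrow> real \<Rightarrow> real" and p :: real
  assumes open_\<Omega>: "open \<Omega>" and nonempty_\<Omega>: "\<Omega> \<noteq> {}"
    and \<beta>_measurable: "\<beta> \<in> borel_measurable (lebesgue_on (- \<Omega>))"
    and s_continuous: "continuous_on UNIV (\<lambda>(x, y). s x y)"
    and phi_continuous: "continuous_on UNIV (phi_of a x y)"
    and musielak_Phi: "musielak_function (\<lambda>(x, y). Phi_of a x y)"
    and musielak_Phi_hat: "musielak_function (Phi_hat a)"
    and p_positive: "0 < p"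
    and upper_exponent: "0 < t \<Longrightarrow> t * phi_of a x y t / Phi_of a x y t \<le> p"
    and Phi_convex_sqrt: "convex_on {0..} (\<lambda>t. Phi_of a x y (sqrt t))"
begin

definition pair_weight :: "(real^'n) \<times> (real^'n) \<Rightarrow> ennreal" where
  "pair_weight z = ennreal (1 / norm (fst z - snd z) ^ CARD('n)) * indicator (- ((- \<Omega>) \<times> (- \<Omega>))) z"

text \<open>The quotient is left without absolute value so that it is linear in u; the modular takes
  the absolute value.\<close>

definition difference_quotient :: "(real^'n \<Rightarrow> real) \<Rightarrow> (real^'n) \<times> (real^'n) \<Rightarrow> real" where
  "difference_quotient u z = (u (fst z) - u (snd z)) / norm (fst z - snd z) powr s (fst z) (snd z)"

definition exterior_weight :: "real^'n \<Rightarrow> ennreal" where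
  "exterior_weight x = ennreal (\<beta> x) * indicator (- \<Omega>) x"

section \<open>Measurability of the weights, and the three integral modulars\<close>

lemma \<Omega>_lebesgue[measurable]: "\<Omega> \<in> sets lebesgue"
  using open_\<Omega> by (simp add: sets_lebesgue_of_borel)

lemma exterior_lebesgue[measurable]: "- \<Omega> \<in> sets lebesgue"
  using open_\<Omega> by (intro sets_lebesgue_of_borel borel_closed) (simp add: closed_Compl)

lemma pair_weight_measurable[measurable]: "pair_weight \<in> borel_measurable lebesgue"
proof -
  have "(\<lambda>z :: (real^'n) \<times> (real^'n). 1 / norm (fst z - snd z) ^ CARD('n)) \<in> borel_measurable borel"
    by (intro borel_measurable_divide borel_measurable_continuous_onI continuous_intros)
  then have [measurable]: "(\<lambda>z :: (real^'n) \<times> (real^'n). 1 / norm (fst z - snd z) ^ CARD('n)) \<in> borel_measurable lebesgue"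
    by (auto intro: measurable_completion)
  have "closed ((- \<Omega>) \<times> (- \<Omega>))" using open_\<Omega> by (intro closed_Times) auto
  then have [measurable]: "- ((- \<Omega>) \<times> (- \<Omega>)) \<in> sets lebesgue"
    by (intro sets_lebesgue_of_borel borel_open) (simp add: open_Compl)
  show ?thesis unfolding pair_weight_def[abs_def] by measurable
qed

lemma exterior_weight_measurable[measurable]: "exterior_weight \<in> borel_measurable lebesgue"
proof -
  have "(\<lambda>x. ennreal (\<beta> x)) \<in> borel_measurable (lebesgue_on (- \<Omega>))"
    using \<beta>_measurable by measurable
  then show ?thesis
    unfolding exterior_weight_def[abs_def]
    by (subst (asm) borel_measurable_restrict_space_iff_ennreal) auto
qed

lemma Phi_growth:
  assumes "1 \<le> r" "0 \<le> t"
  shows "Phi_of a x y (r * t) \<le> r powr p * Phi_of a x y t"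
proof (rule Phi_of_growth)
  have "N_function ((\<lambda>(x, y). Phi_of a x y) (x, y))"
    using musielak_Phi unfolding musielak_function_def by blast
  then show "0 < Phi_of a x y t" if "0 < t" for t using that by (simp add: N_function_def)
qed (use phi_continuous upper_exponent assms in auto)

sublocale pair: musielak "density lebesgue pair_weight" "\<lambda>(x, y). Phi_of a x y" p
proof (rule musielak_density[OF musielak_Phi p_positive])
  fix z :: "(real^'n) \<times> (real^'n)"
  show "(case z of (x, y) \<Rightarrow> Phi_of a x y) (r * t) \<le> r powr p * (case z of (x, y) \<Rightarrow> Phi_of a x y) t"
    if "1 \<le> r" "0 \<le> t" for r t using that by (cases z) (simp add: Phi_growth)
  show "convex_on {0..} (\<lambda>t. (case z of (x, y) \<Rightarrow> Phi_of a x y) (sqrt t))"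
    by (cases z) (simp add: Phi_convex_sqrt)
qed

lemma musielak_hat: "musielak (density lebesgue W) (Phi_hat a) p"
  by (rule musielak_density[OF musielak_Phi_hat p_positive])
    (simp_all add: Phi_hat_def Phi_growth Phi_convex_sqrt)

sublocale interior: musielak "density lebesgue (indicator \<Omega>)" "Phi_hat a" p
  by (rule musielak_hat)

sublocale exterior: musielak "density lebesgue exterior_weight" "Phi_hat a" p
  by (rule musielak_hat)

lemma difference_quotient_measurable:
  assumes "u \<in> borel_measurable lebesgue"
  shows "difference_quotient u \<in> borel_measurable lebesgue"
proof -
  note [measurable] = measurable_lebesgue_fst_snd[OF assms]
  have "(\<lambda>z. s (fst z) (snd z)) \<in> borel_measurable borel"
    using s_continuous by (intro borel_measurable_continuous_onI) (simp add: case_prod_unfold)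
  moreover have "(\<lambda>z :: (real^'n) \<times> (real^'n). norm (fst z - snd z)) \<in> borel_measurable borel"
    by (intro borel_measurable_continuous_onI continuous_intros)
  ultimately have [measurable]: "(\<lambda>z. s (fst z) (snd z)) \<in> borel_measurable lebesgue"
    "(\<lambda>z :: (real^'n) \<times> (real^'n). norm (fst z - snd z)) \<in> borel_measurable lebesgue"
    by (auto intro: measurable_completion)
  show ?thesis unfolding difference_quotient_def[abs_def] by measurable
qed

lemma difference_quotient_linear: "difference_quotient (\<lambda>x. c * u x + d * v x) = (\<lambda>z. c * difference_quotient u z + d * difference_quotient v z)"
  by (rule ext) (simp add: difference_quotient_def add_divide_distrib[symmetric] algebra_simps)

text \<open>Convergence almost everywhere in space passes to almost every pair through both
  coordinates, and the weighted measure has no fewer null sets than Lebesgue measure.\<close>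

lemma modular_pair: "modular lebesgue (\<lambda>u. pair.integral_modular (difference_quotient u)) p"
proof (rule modular_pullback[OF pair.modular_integral_modular])
  show "difference_quotient u \<in> borel_measurable (density lebesgue pair_weight)" if "u \<in> borel_measurable lebesgue" for u
    using difference_quotient_measurable[OF that] by simp
  show "difference_quotient (\<lambda>x. c * u x + d * v x) = (\<lambda>z. c * difference_quotient u z + d * difference_quotient v z)" for c d u v
    by (rule difference_quotient_linear)
  fix w :: "nat \<Rightarrow> real^'n \<Rightarrow> real" and u
  assume *: "AE x in lebesgue. (\<lambda>n. w n x) \<longlonglongrightarrow> u x"
  have "AE z in lebesgue. (\<lambda>n. difference_quotient (w n) z) \<longlonglongrightarrow> difference_quotient u z"
    using AE_lebesgue_prod(1)[OF *, where 'b = "real^'n"] AE_lebesgue_prod(2)[OF *, where 'b = "real^'n"]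
  proof eventually_elim
    case (elim z)
    then show ?case unfolding difference_quotient_def divide_inverse by (intro tendsto_intros)
  qed
  then show "AE z in density lebesgue pair_weight. (\<lambda>n. difference_quotient (w n) z) \<longlonglongrightarrow> difference_quotient u z"
    by (simp add: AE_density) (auto elim: eventually_mono)
qed

text \<open>Modulars can be added only over a common measure. Lebesgue null sets are null for the
  density, so pulling back along the identity moves the modular to Lebesgue measure.\<close>

lemma modular_density:
  assumes "modular (density lebesgue W) \<rho> p" and [measurable]: "W \<in> borel_measurable lebesgue"
  shows "modular lebesgue \<rho> p"
proof -
  have "modular lebesgue (\<lambda>u. \<rho> ((\<lambda>u. u) u)) p"
    by (rule modular_pullback[OF assms(1)]) (auto simp: AE_density elim: eventually_mono)
  then show ?thesis by simp
qed

lemma modular_interior: "modular lebesgue interior.integral_modular p"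
  by (rule modular_density[OF interior.modular_integral_modular]) measurable

lemma modular_exterior: "modular lebesgue exterior.integral_modular p"
  by (rule modular_density[OF exterior.modular_integral_modular]) measurable

section \<open>The three terms of the norm as gauges\<close>

lemma luxemburg_cong: "(\<And>l. 0 < l \<Longrightarrow> \<rho> l = \<sigma> l) \<Longrightarrow> luxemburg \<rho> = luxemburg \<sigma>"
  unfolding luxemburg_def by (intro arg_cong[where f = Inf] Collect_cong) auto

lemma frac_seminorm_eq:
  assumes u: "u \<in> borel_measurable lebesgue"
  shows "frac_seminorm \<Omega> s (Phi_of a) u = modular.gauge (\<lambda>u. pair.integral_modular (difference_quotient u)) u"
  unfolding frac_seminorm_def modular.gauge_def[OF modular_pair]
proof (rule luxemburg_cong)
  fix l :: real assume l: "0 < l"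
  have [measurable]: "difference_quotient (\<lambda>x. u x / l) \<in> borel_measurable lebesgue"
    using u by (intro difference_quotient_measurable) auto
  have [measurable]: "(\<lambda>z. (case z of (x, y) \<Rightarrow> Phi_of a x y) \<bar>difference_quotient (\<lambda>x. u x / l) z\<bar>) \<in> borel_measurable lebesgue"
    using pair.measurable_superposition[of "difference_quotient (\<lambda>x. u x / l)"] by simp
  have "pair.integral_modular (difference_quotient (\<lambda>x. u x / l))
      = (\<integral>\<^sup>+ z. pair_weight z * ennreal ((case z of (x, y) \<Rightarrow> Phi_of a x y) \<bar>difference_quotient (\<lambda>x. u x / l) z\<bar>) \<partial>lebesgue)"
    unfolding pair.integral_modular_def by (rule nn_integral_density) measurable
  also have "\<dots> = (\<integral>\<^sup>+ (x, y) \<in> - ((- \<Omega>) \<times> (- \<Omega>)).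
      ennreal (Phi_of a x y (\<bar>u x - u y\<bar> / (l * norm (x - y) powr s x y)) / norm (x - y) ^ CARD('n)) \<partial>lebesgue)"
  \<comment> \<open>The integrands agree at every pair; on the diagonal both vanish because division
    by 0 gives 0.\<close>
  proof (rule nn_integral_cong)
    fix z :: "(real^'n) \<times> (real^'n)"
    obtain x y where z: "z = (x, y)" by (cases z)
    have q: "\<bar>difference_quotient (\<lambda>x. u x / l) z\<bar> = \<bar>u x - u y\<bar> / (l * norm (x - y) powr s x y)"
      using l by (simp add: difference_quotient_def z diff_divide_distrib[symmetric] abs_divide)
    show "pair_weight z * ennreal ((case z of (x, y) \<Rightarrow> Phi_of a x y) \<bar>difference_quotient (\<lambda>x. u x / l) z\<bar>)
      = (case z of (x, y) \<Rightarrow> ennreal (Phi_of a x y (\<bar>u x - u y\<bar> / (l * norm (x - y) powr s x y))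
          / norm (x - y) ^ CARD('n))) * indicator (- ((- \<Omega>) \<times> (- \<Omega>))) z"
      unfolding q using ennreal_mult'[of "1 / norm (x - y) ^ CARD('n)"
          "Phi_of a x y (\<bar>u x - u y\<bar> / (l * norm (x - y) powr s x y))"]
      by (simp add: z pair_weight_def ac_simps)
  qed
  finally show "(\<integral>\<^sup>+ (x, y) \<in> - ((- \<Omega>) \<times> (- \<Omega>)).
      ennreal (Phi_of a x y (\<bar>u x - u y\<bar> / (l * norm (x - y) powr s x y)) / norm (x - y) ^ CARD('n)) \<partial>lebesgue)
      = pair.integral_modular (difference_quotient (\<lambda>x. u x / l))" by simp
qed

lemma hat_superposition_measurable:
  assumes "u \<in> borel_measurable lebesgue"
  shows "(\<lambda>x. Phi_hat a x \<bar>u x\<bar>) \<in> borel_measurable lebesgue"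
  using interior.measurable_superposition[of u] assms by simp

lemma domain_norm_eq:
  assumes [measurable]: "u \<in> borel_measurable lebesgue"
  shows "domain_norm \<Omega> (Phi_hat a) u = modular.gauge interior.integral_modular u"
  unfolding domain_norm_def modular.gauge_def[OF modular_interior]
proof (rule luxemburg_cong)
  fix l :: real assume l: "0 < l"
  have [measurable]: "(\<lambda>x. Phi_hat a x \<bar>u x / l\<bar>) \<in> borel_measurable lebesgue"
    by (rule hat_superposition_measurable) measurable
  have "interior.integral_modular (\<lambda>x. u x / l)
      = (\<integral>\<^sup>+ x. indicator \<Omega> x * ennreal (Phi_hat a x \<bar>u x / l\<bar>) \<partial>lebesgue)"
    unfolding interior.integral_modular_def by (rule nn_integral_density) measurable
  then show "(\<integral>\<^sup>+ x \<in> \<Omega>. ennreal (Phi_hat a x (\<bar>u x\<bar> / l)) \<partial>lebesgue)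
      = interior.integral_modular (\<lambda>x. u x / l)"
    using l by (simp add: mult.commute)
qed

lemma exterior_norm_eq:
  assumes [measurable]: "u \<in> borel_measurable lebesgue"
  shows "exterior_norm \<Omega> \<beta> (Phi_hat a) u = modular.gauge exterior.integral_modular u"
  unfolding exterior_norm_def modular.gauge_def[OF modular_exterior]
proof (rule luxemburg_cong)
  fix l :: real assume l: "0 < l"
  have [measurable]: "(\<lambda>x. Phi_hat a x \<bar>u x / l\<bar>) \<in> borel_measurable lebesgue"
    by (rule hat_superposition_measurable) measurable
  have "exterior.integral_modular (\<lambda>x. u x / l)
      = (\<integral>\<^sup>+ x. exterior_weight x * ennreal (Phi_hat a x \<bar>u x / l\<bar>) \<partial>lebesgue)"
    unfolding exterior.integral_modular_def by (rule nn_integral_density) measurable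
  \<comment> \<open>On the null set where \<beta> may be negative both integrands are 0, since
    \<open>ennreal\<close> truncates and \<open>Phi_hat\<close> is nonnegative at nonnegative
    arguments.\<close>
  also have "\<dots> = (\<integral>\<^sup>+ x \<in> - \<Omega>. ennreal (\<beta> x * Phi_hat a x (\<bar>u x\<bar> / l)) \<partial>lebesgue)"
    using l by (intro nn_integral_cong)
      (simp add: exterior_weight_def ennreal_mult'' exterior.nonneg ac_simps)
  finally show "(\<integral>\<^sup>+ x \<in> - \<Omega>. ennreal (\<beta> x * Phi_hat a x (\<bar>u x\<bar> / l)) \<partial>lebesgue)
      = exterior.integral_modular (\<lambda>x. u x / l)" by simp
qed

text \<open>
  The differences \<open>w n x - w n y\<close> converge for almost every \<open>(x, y) \<in> \<Omega> \<times> - \<Omega>\<close>, so convergence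
  spreads from a single good point \<open>x \<in> \<Omega>\<close> to almost all of the exterior.
\<close>

lemma AE_convergent_of_modulars:
  assumes w: "\<And>n. w n \<in> borel_measurable lebesgue"
    and pair_small: "\<And>n. pair.integral_modular (difference_quotient (\<lambda>x. 2 ^ n * (w (Suc n) x - w n x))) \<le> ennreal ((1 / 2) ^ n)"
    and interior_small: "\<And>n. interior.integral_modular (\<lambda>x. 2 ^ n * (w (Suc n) x - w n x)) \<le> ennreal ((1 / 2) ^ n)"
  shows "AE x in lebesgue. convergent (\<lambda>n. w n x)"
proof -
  have "AE x in density lebesgue (indicator \<Omega>). convergent (\<lambda>n. w n x)"
    by (rule interior.AE_convergent[OF _ interior_small]) (simp add: w)
  then have inside: "AE x in lebesgue. x \<in> \<Omega> \<longrightarrow> convergent (\<lambda>n. w n x)"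
    by (simp add: AE_density) (auto elim: eventually_mono simp: indicator_def)
  have "AE z in density lebesgue pair_weight. convergent (\<lambda>n. difference_quotient (w n) z)"
  proof (rule pair.AE_convergent)
    show "difference_quotient (w n) \<in> borel_measurable (density lebesgue pair_weight)" for n
      using difference_quotient_measurable[OF w] by simp
    have "difference_quotient (\<lambda>x. 2 ^ n * (w (Suc n) x - w n x)) = (\<lambda>z. 2 ^ n * (difference_quotient (w (Suc n)) z - difference_quotient (w n) z))" for n
      using difference_quotient_linear[of "2 ^ n" "w (Suc n)" "- (2 ^ n)" "w n"] by (simp add: right_diff_distrib)
    then show "pair.integral_modular (\<lambda>z. 2 ^ n * (difference_quotient (w (Suc n)) z - difference_quotient (w n) z)) \<le> ennreal ((1 / 2) ^ n)" for n
      using pair_small[of n] by simp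
  qed
  then have "AE z in lebesgue. 0 < pair_weight z \<longrightarrow> convergent (\<lambda>n. difference_quotient (w n) z)"
    by (simp add: AE_density)
  from AE_lebesgue_pair[OF this]
  have "AE x in lebesgue. (x \<in> \<Omega> \<longrightarrow> convergent (\<lambda>n. w n x)) \<and>
      (AE y in lebesgue. 0 < pair_weight (x, y) \<longrightarrow> convergent (\<lambda>n. difference_quotient (w n) (x, y)))"
    using inside by eventually_elim simp
  \<comment> \<open>Either a good point exists in \<Omega> or almost every point avoids \<Omega>;
    the latter is impossible for a nonempty open set, which has positive measure.\<close>
  then have "(AE x in lebesgue. x \<notin> \<Omega>) \<or> (\<exists>x\<in>\<Omega>. convergent (\<lambda>n. w n x) \<and>
      (AE y in lebesgue. 0 < pair_weight (x, y) \<longrightarrow> convergent (\<lambda>n. difference_quotient (w n) (x, y))))"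
    by - (rule disjCI, erule eventually_mono, blast)
  moreover have "\<not> (AE x in lebesgue. x \<notin> \<Omega>)"
    using open_not_negligible[OF open_\<Omega> nonempty_\<Omega>] AE_iff_null_sets[OF \<Omega>_lebesgue]
    by (simp add: negligible_iff_null_sets)
  ultimately obtain x where x: "x \<in> \<Omega>" "convergent (\<lambda>n. w n x)"
    and y: "AE y in lebesgue. 0 < pair_weight (x, y) \<longrightarrow> convergent (\<lambda>n. difference_quotient (w n) (x, y))"
    by blast
  from y inside show ?thesis
  proof eventually_elim
    case (elim y)
    show ?case
    proof (cases "y \<in> \<Omega>")
      case True
      then show ?thesis using elim by blast
    next
      case False
      then have xy: "0 < norm (x - y)" using x by auto
      then have "0 < pair_weight (x, y)"
        using x by (simp add: pair_weight_def indicator_def)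
      then have q: "convergent (\<lambda>n. difference_quotient (w n) (x, y))" using elim by blast
      \<comment> \<open>With x and y fixed, the factor in front of the quotient does not depend on
        n, so the values at y are a convergent combination of two convergent sequences.\<close>
      have "w n y = w n x - norm (x - y) powr s x y * difference_quotient (w n) (x, y)" for n
        using xy by (simp add: difference_quotient_def)
      then show ?thesis
        using convergent_diff[OF x(2) convergent_mult[OF convergent_const q]] by simp
    qed
  qed
qed

sublocale complete_modular_norm
  "\<lambda>u. pair.integral_modular (difference_quotient u) + interior.integral_modular u + exterior.integral_modular u"
  p "X_norm \<Omega> \<beta> s a"
proof (rule complete_modular_norm_sum3[OF modular_pair modular_interior modular_exterior])
  fix u :: "real^'n \<Rightarrow> real" assume "u \<in> borel_measurable lebesgue"
  then show "X_norm \<Omega> \<beta> s a u = modular.gauge (\<lambda>u. pair.integral_modular (difference_quotient u)) u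
      + modular.gauge interior.integral_modular u + modular.gauge exterior.integral_modular u"
    unfolding X_norm_def by (simp only: frac_seminorm_eq domain_norm_eq exterior_norm_eq)
qed (rule AE_convergent_of_modulars)

end

lemma fractional_musielakI:
  fixes \<Omega> :: "(real^'n) set"
  assumes "open \<Omega>" "\<Omega> \<noteq> {}" "\<beta> \<in> borel_measurable (lebesgue_on (- \<Omega>))"
    "continuous_on UNIV (\<lambda>(x, y). s x y)" "\<And>x y. \<exists>g. homeomorphism UNIV UNIV (phi_of a x y) g"
    "musielak_function (\<lambda>(x, y). Phi_of a x y)" "musielak_function (Phi_hat a)" "1 < q"
    "\<And>x y t. 0 < t \<Longrightarrow> q \<le> t * phi_of a x y t / Phi_of a x y t \<and> t * phi_of a x y t / Phi_of a x y t \<le> p"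
    "\<And>x y. convex_on {0..} (\<lambda>t. Phi_of a x y (sqrt t))"
  shows "fractional_musielak \<Omega> \<beta> s a p"
proof
  \<comment> \<open>Evaluating the two-sided exponent bound at one arbitrary pair of points and t =
    1 already orders the two exponents.\<close>
  have "q \<le> p" using assms(9)[of 1 undefined undefined] by simp
  then show "0 < p" using assms(8) by simp
  show "continuous_on UNIV (phi_of a x y)" for x y
    using assms(5)[of x y] by (auto simp: homeomorphism_def)
qed (fact assms(1-4,6,7,10) | use assms(9) in blast)+

theorem proposition3p3:
  fixes \<Omega> :: "(real^'n) set"
    and \<beta> :: "real^'n \<Rightarrow> real"
    and s :: "nat \<Rightarrow> real^'n \<Rightarrow> real^'n \<Rightarrow> real"
    and a :: "nat \<Rightarrow> real^'n \<Rightarrow> real^'n \<Rightarrow> real \<Rightarrow> real"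
    and \<phi>m \<phi>p :: "nat \<Rightarrow> real"
  assumes "open \<Omega>" and "bounded \<Omega>" and "\<Omega> \<noteq> {}" and "lipschitz_boundary \<Omega>"
    and "\<beta> \<in> borel_measurable (lebesgue_on (- \<Omega>))"
    and "\<exists>C. AE x in lebesgue_on (- \<Omega>). \<bar>\<beta> x\<bar> \<le> C"
    and "AE x in lebesgue_on (- \<Omega>). 0 \<le> \<beta> x"
    and "\<And>i x y. i \<in> {1, 2} \<Longrightarrow> 0 < s i x y \<and> s i x y < 1"
    and "\<And>i. i \<in> {1, 2} \<Longrightarrow> continuous_on UNIV (\<lambda>(x, y). s i x y)"
    and "\<And>i x y. i \<in> {1, 2} \<Longrightarrow> s i x y = s i y x"
    and "\<And>i. i \<in> {1, 2} \<Longrightarrow> 0 < (INF (x, y). s i x y)"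
    and "\<And>i. i \<in> {1, 2} \<Longrightarrow> (SUP (x, y). s i x y) < 1"
    and "\<And>i x y t. i \<in> {1, 2} \<Longrightarrow> a i x y t = a i y x t"
    and "\<And>i x y. i \<in> {1, 2} \<Longrightarrow> strict_mono (phi_of (a i) x y)"
    and "\<And>i x y. i \<in> {1, 2} \<Longrightarrow> \<exists>g. homeomorphism UNIV UNIV (phi_of (a i) x y) g"
    and "\<And>i. i \<in> {1, 2} \<Longrightarrow> musielak_function (\<lambda>(x, y). Phi_of (a i) x y)"
    and "\<And>i. i \<in> {1, 2} \<Longrightarrow> musielak_function (Phi_hat (a i))"
    and "\<And>i. i \<in> {1, 2} \<Longrightarrow> 1 < \<phi>m i"
    and "\<And>i x y t. \<lbrakk>i \<in> {1, 2}; 0 < t\<rbrakk> \<Longrightarrow>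
           \<phi>m i \<le> t * phi_of (a i) x y t / Phi_of (a i) x y t \<and>
           t * phi_of (a i) x y t / Phi_of (a i) x y t \<le> \<phi>p i"
    and "\<And>i x y. i \<in> {1, 2} \<Longrightarrow> convex_on {0..} (\<lambda>t. Phi_of (a i) x y (sqrt t))"
  shows "\<forall>i\<in>{1, 2}. banach_space (X_space \<Omega> \<beta> (s i) (a i)) \<and>
                    reflexive_space (X_space \<Omega> \<beta> (s i) (a i))"
proof (intro ballI)
  fix i :: nat assume i: "i \<in> {1, 2}"
  \<comment> \<open>The upper exponent \<open>\<phi>p i\<close> becomes the growth exponent of all
    three modulars.\<close>
  interpret fractional_musielak \<Omega> \<beta> "s i" "a i" "\<phi>p i"
    by (rule fractional_musielakI[where q = "\<phi>m i"])
      (rule assms(1) assms(3) assms(5) assms(9)[OF i] assms(15-19)[OF i] assms(20)[OF i] | assumption)+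
  show "banach_space (X_space \<Omega> \<beta> (s i) (a i)) \<and> reflexive_space (X_space \<Omega> \<beta> (s i) (a i))"
    unfolding X_space_eq_class_space using banach_space reflexive_space by blast
qed

end
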